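(* Let $K=\mathbb{F}_2(t)$ and for $y\in K$ let $C_y\subseteq\mathbb{P}^2_K$ be the conic $x_0^2+x_0x_1+yx_1^2=tx_2^2$. For $B\in\{2^M: M\in\mathbb{Z}_{\ge 0}\}$ put \[N(B)=\#\{y\in K: H(y)=B,\ C_y(K)\neq\emptyset\}.\] Then, as $B\to\infty$ through powers of $2$, \[N(B)=\frac{cB^{2}}{(\log B)^{1/2}}+O\!\left(\frac{B^2}{(\log B)^{3/2}}\right),\] where \[c=4\left(\frac{2\log 2}{\pi}\right)^{1/2}\prod_{\omega\in\Omega_K}\left(1-\frac{1}{2^{\deg\omega}}\right)^{1/2}c_\omega,\] with $c_\omega=\frac12\cdot\frac{1-2^{-2}}{1-2^{-1}}=\frac34$ for $\omega\in\{t,t^{-1}\}$ and \[c_\omega=1+\frac12\left(\frac{1}{2^{\deg\omega}}\left(1+\frac{1-2^{-\deg\omega}}{2^{\deg\omega}-1}\right)-\frac{1}{2^{2\deg\omega-1}}\right)\] for $\omega\notin\{t,t^{-1}\}$.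
   Context: $\Omega_K$ is the set of places of $K=\mathbb{F}_2(t)$: each place corresponds either to a monic irreducible polynomial $\omega\in\mathbb{F}_2[t]$ (with $\deg\omega$ its degree) or to the place at infinity $t^{-1}$, with the convention $\deg t^{-1}=1$. For a place $\omega$ with valuation $v_\omega$, the normalized absolute value is $|y|_\omega=2^{-\deg\omega\cdot v_\omega(y)}$. The height of $y\in K$ is $H(y)=\prod_{\omega\in\Omega_K}\max\{1,|y|_\omega\}$. *)

theory Defs
  imports "HOL-Analysis.Analysis" "HOL-Library.Z2" "HOL-Library.Landau_Symbols"
    "HOL-Computational_Algebra.Computational_Algebra"
    
begin

type_synonym K = "bit poly fract"

definition tK :: K where "tK = to_fract [:0, 1:]"

datatype place = Fin "bit poly" | Infty

definition places :: "place set" where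
  "places = {Fin p | p. lead_coeff p = 1 \<and> irreducible p} \<union> {Infty}"

fun deg_place :: "place \<Rightarrow> nat" where
  "deg_place (Fin p) = degree p"
| "deg_place Infty = 1"

text \<open>A representation y = a/b with b \<noteq> 0 (chosen arbitrarily; the valuation below
  does not depend on the choice).\<close>
definition rep :: "K \<Rightarrow> bit poly \<times> bit poly" where
  "rep y = (SOME (a, b). b \<noteq> 0 \<and> y = Fract a b)"

definition pmult :: "bit poly \<Rightarrow> bit poly \<Rightarrow> nat" where
  "pmult p a = (GREATEST k. p ^ k dvd a)"

text \<open>Valuation of a nonzero element of K (for y = 0 the value is irrelevant, see absval).\<close>
fun val :: "place \<Rightarrow> K \<Rightarrow> int" where
  "val (Fin p) y = (case rep y of (a, b) \<Rightarrow>
      int (pmult p a) - int (pmult p b))"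
| "val Infty y = (case rep y of (a, b) \<Rightarrow> int (degree b) - int (degree a))"

definition absval :: "place \<Rightarrow> K \<Rightarrow> real" where
  "absval w y = (if y = 0 then 0 else 2 powr (- real (deg_place w) * real_of_int (val w y)))"

text \<open>Height: the product over all places of max 1 |y|_w; all but finitely many factors
  equal 1, so the product is taken over the places where the factor differs from 1.\<close>
definition height :: "K \<Rightarrow> real" where
  "height y = (\<Prod>w \<in> {w \<in> places. max 1 (absval w y) \<noteq> 1}. max 1 (absval w y))"

definition conic_has_point :: "K \<Rightarrow> bool" where
  "conic_has_point y \<longleftrightarrow> (\<exists>x0 x1 x2 :: K. (x0, x1, x2) \<noteq> (0, 0, 0) \<and>
      x0^2 + x0 * x1 + y * x1^2 = tK * x2^2)"

definition N :: "real \<Rightarrow> nat" where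
  "N B = card {y :: K. height y = B \<and> conic_has_point y}"

definition c_loc :: "place \<Rightarrow> real" where
  "c_loc w = (if w = Fin [:0, 1:] \<or> w = Infty then 1/2 * (1 - 2 powr -2) / (1 - 2 powr -1)
     else (let d = real (deg_place w) in
       1 + 1/2 * (1 / 2 powr d * (1 + (1 - 2 powr (-d)) / (2 powr d - 1)) - 1 / 2 powr (2*d - 1))))"

text \<open>Euler factor at w; the infinite product over all places is the limit of the
  partial products over places of degree at most n.\<close>
definition euler_factor :: "place \<Rightarrow> real" where
  "euler_factor w = sqrt (1 - 1 / 2 powr real (deg_place w)) * c_loc w"

definition partial_euler :: "nat \<Rightarrow> real" where
  "partial_euler n = (\<Prod>w \<in> {w \<in> places. deg_place w \<le> n}. euler_factor w)"

end

theory Submission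
  imports Defs
begin

text \<open>
  Dehomogenising, the conic has a point iff \<open>y = u\<^sup>2 + u + t v\<^sup>2\<close> for some \<open>u, v \<in> K\<close>, and such \<open>y\<close> form
  an additive group \<open>S\<close>. Let \<open>C\<close> be the additive operator \<open>p\<^sup>2 + t q\<^sup>2 \<mapsto> p\<close> on \<open>K\<close> (the Cartier
  operator, after \<open>y\<close> is identified with the differential \<open>y dt/t\<close>). On the finite space of all \<open>a/b\<close>
  with \<open>b\<close> fixed and \<open>deg a \<le> M\<close>, where \<open>deg b \<le> M\<close>, the group \<open>S\<close> is exactly the image of \<open>1 + C\<close>,
  and the kernel of \<open>1 + C\<close> consists of the logarithmic derivatives \<open>t f'/f\<close> with \<open>f\<close> dividing \<open>t\<close> times
  the product of the primes \<open>\<noteq> t\<close> that divide \<open>b\<close>. Hence exactly \<open>2\<^sup>M / 2\<^bsup>\<omega>(b)\<^esup>\<close> numerators \<open>a\<close> are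
  admissible, where \<open>\<omega>(b)\<close> counts the prime divisors of \<open>b\<close> other than \<open>t\<close>. Summing over \<open>b\<close> gives the
  exact formula that \<open>2\<^sup>M R(M)\<close> elements of \<open>S\<close> have height at most \<open>2\<^sup>M\<close>, with \<open>R(k)\<close> the sum of
  \<open>2\<^bsup>-\<omega>(b)\<^esup>\<close> over all \<open>b\<close> of degree \<open>k\<close>.

  The generating function of \<open>R\<close> equals \<open>(1 - 2v)\<^bsup>-1/2\<^esup>\<close> times
  \<open>(1 - v)\<^bsup>-1/2\<^esup> \<Prod>\<^sub>p e(v\<^bsup>deg p\<^esup>)\<close>, the product being over the primes \<open>p \<noteq> t\<close> and
  \<open>e(x) = (1 - x/2)(1 - x)\<^bsup>-1/2\<^esup> = 1 + O(x\<^sup>2)\<close>. The last factor has nonnegative coefficients and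
  converges beyond \<open>v = 1/2\<close>, so the asymptotics of \<open>R\<close> are those of the central binomial
  coefficients, which Wallis' product provides with the required error term.
\<close>

section \<open>Polynomials and rational functions over the field with two elements\<close>

text \<open>These instances make \<open>bit poly\<close> a Euclidean gcd ring with unique prime
  factorisation. The only nonzero element of \<open>bit\<close> is the unit 1, which is why
  \<open>normalize\<close> and \<open>unit_factor\<close> can both be the identity.\<close>

instantiation bit ::
  "{unique_euclidean_ring, normalization_euclidean_semiring, normalization_semidom_multiplicative}"
begin

definition normalize_bit :: "bit \<Rightarrow> bit" where [simp]: "normalize_bit x = x"
definition unit_factor_bit :: "bit \<Rightarrow> bit" where [simp]: "unit_factor_bit x = x"
definition euclidean_size_bit :: "bit \<Rightarrow> nat" where
  [simp]: "euclidean_size_bit x = (if x = 0 then 0 else 1)"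
definition division_segment_bit :: "bit \<Rightarrow> bit" where [simp]: "division_segment_bit x = 1"

instance
  by standard (auto simp: dvd_field_iff field_simps)

end

instantiation bit :: euclidean_ring_gcd
begin
definition gcd_bit :: "bit \<Rightarrow> bit \<Rightarrow> bit" where "gcd_bit = Euclidean_Algorithm.gcd"
definition lcm_bit :: "bit \<Rightarrow> bit \<Rightarrow> bit" where "lcm_bit = Euclidean_Algorithm.lcm"
definition Gcd_bit :: "bit set \<Rightarrow> bit" where "Gcd_bit = Euclidean_Algorithm.Gcd"
definition Lcm_bit :: "bit set \<Rightarrow> bit" where "Lcm_bit = Euclidean_Algorithm.Lcm"
instance by standard (simp_all add: gcd_bit_def lcm_bit_def Gcd_bit_def Lcm_bit_def)
end

instance bit :: field_gcd ..

definition tX :: "bit poly" where "tX = [:0, 1:]"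

section \<open>Characteristic two in \<open>bit poly\<close> and \<open>K\<close>\<close>

lemma bit_poly_two [simp]: "(2 :: bit poly) = 0"
proof -
  have "(2 :: bit poly) = [:2:]" by (simp add: numeral_poly)
  then show ?thesis by simp
qed

lemma bit_poly_add_self [simp]: "(p :: bit poly) + p = 0"
  by (metis bit_poly_two mult_2 mult_zero_left)

lemma bit_poly_add_self_left [simp]: "(p :: bit poly) + (p + q) = q"
  by (simp flip: add.assoc)

lemma bit_poly_uminus [simp]: "- (p :: bit poly) = p"
  by (metis bit_poly_add_self minus_unique)

lemma bit_poly_minus [simp]: "(p :: bit poly) - q = p + q"
  by (metis bit_poly_uminus diff_conv_add_uminus)

lemma bit_poly_add_eq_0_iff: "(p :: bit poly) + q = 0 \<longleftrightarrow> p = q"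
  by (metis bit_poly_minus eq_iff_diff_eq_0)

lemma bit_poly_square_add: "((p :: bit poly) + q)\<^sup>2 = p\<^sup>2 + q\<^sup>2"
  by (simp add: power2_sum)

lemma K_two [simp]: "(2 :: K) = 0"
proof -
  have "(2 :: K) = Fract (1 + 1) 1" by (simp add: One_fract_def flip: one_add_one)
  then show ?thesis by (simp add: Zero_fract_def)
qed

lemma K_add_self [simp]: "(x :: K) + x = 0"
  by (metis K_two mult_2 mult_zero_left)

lemma K_uminus [simp]: "- (x :: K) = x"
  by (metis K_add_self minus_unique)

lemma K_minus [simp]: "(x :: K) - y = x + y"
  by (metis K_uminus diff_conv_add_uminus)

lemma K_add_eq_0_iff: "(x :: K) + y = 0 \<longleftrightarrow> x = y"
  by (metis K_minus eq_iff_diff_eq_0)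

lemma K_square_add: "((x :: K) + y)\<^sup>2 = x\<^sup>2 + y\<^sup>2"
  by (simp add: power2_sum)

lemma bit_poly_lead_coeff: "(p :: bit poly) \<noteq> 0 \<Longrightarrow> lead_coeff p = 1"
  using bit_not_zero_iff leading_coeff_0_iff by blast

lemma bit_poly_normalize [simp]: "normalize (p :: bit poly) = p"
proof (cases "p = 0")
  case False
  then show ?thesis
    using bit_poly_lead_coeff[OF False] by (simp add: normalize_poly_def unit_factor_poly_def flip: one_pCons)
qed simp

lemma bit_poly_is_unit_iff: "is_unit (p :: bit poly) \<longleftrightarrow> p = 1"
  by (metis bit_poly_normalize is_unit_normalize dvd_refl)

lemma bit_poly_dvd_antisym: "(p :: bit poly) dvd q \<Longrightarrow> q dvd p \<Longrightarrow> p = q"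
  by (rule associated_eqI) simp_all

lemma bit_poly_degree_0: "degree (p :: bit poly) = 0 \<Longrightarrow> p = 0 \<or> p = 1"
  by (erule degree_eq_zeroE) (metis (full_types) bit_not_zero_iff one_pCons pCons_0_0)

lemma prime_iff_irreducible: "prime (p :: bit poly) \<longleftrightarrow> irreducible p"
  using prime_elem_iff_irreducible[of p] by (auto simp: prime_def)

lemma prime_degree_pos: "prime (p :: bit poly) \<Longrightarrow> degree p > 0"
  using bit_poly_degree_0[of p] by (cases "degree p = 0") auto

section \<open>Derivatives and the splitting into even and odd powers\<close>

lemma pderiv_square: "pderiv ((p :: bit poly)\<^sup>2) = 0"
  by (simp add: power2_eq_square pderiv_mult mult.commute)

lemma pderiv_tX [simp]: "pderiv tX = 1"
  by (simp add: tX_def pderiv_pCons)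

lemma pderiv_tX_mult: "pderiv (tX * p) = p + tX * pderiv p"
  by (simp add: pderiv_mult add.commute)

text \<open>Squares have derivative zero, so differentiation isolates the odd part \<open>d\<close>;
  most facts about the Cartier operator rest on this.\<close>

lemma pderiv_square_decomposition: "pderiv (g\<^sup>2 + tX * d\<^sup>2) = d\<^sup>2"
  by (simp add: pderiv_add pderiv_square pderiv_tX_mult)

text \<open>Even and odd powers of t are collected separately; each half is a square because
  Frobenius fixes the coefficients. Prepending a coefficient multiplies by t and exchanges the two
  halves.\<close>

lemma square_decomposition_exists: "\<exists>g d. (p :: bit poly) = g\<^sup>2 + tX * d\<^sup>2"
proof (induction p)
  case 0
  show ?case by (rule exI[of _ 0], rule exI[of _ 0]) simp
next
  case (pCons a p)
  then obtain g d where p: "p = g\<^sup>2 + tX * d\<^sup>2" by blast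
  have "pCons a p = [:a:] + tX * p" by (simp add: tX_def)
  also have "[:a:] = [:a:]\<^sup>2" by (cases a) (simp_all add: power2_eq_square)
  also have "[:a:]\<^sup>2 + tX * p = ([:a:] + tX * d)\<^sup>2 + tX * g\<^sup>2"
    unfolding p bit_poly_square_add by (simp add: power_mult_distrib power2_eq_square distrib_left mult_ac add_ac)
  finally show ?case by blast
qed

lemma square_decomposition_unique:
  assumes "(g :: bit poly)\<^sup>2 + tX * d\<^sup>2 = g'\<^sup>2 + tX * d'\<^sup>2"
  shows "g = g'" "d = d'"
proof -
  have "d\<^sup>2 = d'\<^sup>2" using arg_cong[OF assms, of pderiv] by (simp only: pderiv_square_decomposition)
  then have "(d + d')\<^sup>2 = 0" by (simp add: bit_poly_square_add)
  then show "d = d'" by (simp add: bit_poly_add_eq_0_iff)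
  then have "(g + g')\<^sup>2 = 0" using assms by (simp add: bit_poly_square_add)
  then show "g = g'" by (simp add: bit_poly_add_eq_0_iff)
qed

text \<open>The Cartier operator sends \<open>a/b = ab/b\<^sup>2\<close> to \<open>cartier (a * b) / b\<close>.\<close>
definition cartier :: "bit poly \<Rightarrow> bit poly" where
  "cartier p = (THE g. \<exists>d. p = g\<^sup>2 + tX * d\<^sup>2)"

lemma cartier_eqI: "p = g\<^sup>2 + tX * d\<^sup>2 \<Longrightarrow> cartier p = g"
  unfolding cartier_def using square_decomposition_unique(1) by blast

lemma cartier_decomposition: obtains d where "p = (cartier p)\<^sup>2 + tX * d\<^sup>2"
proof -
  obtain g d where "p = g\<^sup>2 + tX * d\<^sup>2" using square_decomposition_exists by blast
  with cartier_eqI[OF this] that show thesis by blast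
qed

lemma cartier_add: "cartier (p + q) = cartier p + cartier q"
proof -
  obtain d where d: "p = (cartier p)\<^sup>2 + tX * d\<^sup>2" by (rule cartier_decomposition)
  obtain e where e: "q = (cartier q)\<^sup>2 + tX * e\<^sup>2" by (rule cartier_decomposition)
  have "p + q = (cartier p)\<^sup>2 + tX * d\<^sup>2 + ((cartier q)\<^sup>2 + tX * e\<^sup>2)"
    using d e by argo
  also have "\<dots> = (cartier p + cartier q)\<^sup>2 + tX * (d + e)\<^sup>2"
    unfolding bit_poly_square_add by (simp add: algebra_simps)
  finally show ?thesis by (rule cartier_eqI)
qed

text \<open>Linearity with respect to the inverse of Frobenius: squares leave the operator as their
  roots. This allows changes of denominator.\<close>

lemma cartier_square_mult: "cartier (q\<^sup>2 * p) = q * cartier p"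
proof -
  obtain d where d: "p = (cartier p)\<^sup>2 + tX * d\<^sup>2" by (rule cartier_decomposition)
  have "q\<^sup>2 * p = (q * cartier p)\<^sup>2 + tX * (q * d)\<^sup>2"
    by (subst d) (simp add: algebra_simps power_mult_distrib)
  then show ?thesis by (rule cartier_eqI)
qed

lemma degree_square: "degree ((p :: 'a :: idom poly)\<^sup>2) = 2 * degree p"
  by (cases "p = 0") (simp_all add: degree_power_eq)

lemma degree_tX_mult: "p \<noteq> 0 \<Longrightarrow> degree (tX * p) = Suc (degree p)"
  by (simp add: tX_def)

text \<open>The degrees of the two nonzero summands have opposite parity, so their leading terms
  cannot cancel.\<close>

lemma degree_cartier_le: "2 * degree (cartier p) \<le> degree p"
proof -
  obtain d where d: "p = (cartier p)\<^sup>2 + tX * d\<^sup>2" by (rule cartier_decomposition)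
  show ?thesis
  proof (cases "d = 0")
    case True
    then show ?thesis using arg_cong[OF d, of degree] by (simp add: degree_square)
  next
    case False
    then have e: "degree (tX * d\<^sup>2) = Suc (2 * degree d)"
      by (subst degree_tX_mult) (simp_all add: degree_square)
    have "degree ((cartier p)\<^sup>2) \<noteq> degree (tX * d\<^sup>2)"
      unfolding e degree_square by presburger
    then have "degree p \<ge> degree ((cartier p)\<^sup>2)"
      using degree_add_eq_left[of "tX * d\<^sup>2" "(cartier p)\<^sup>2"]
        degree_add_eq_right[of "(cartier p)\<^sup>2" "tX * d\<^sup>2"] d[symmetric]
      by (cases "degree ((cartier p)\<^sup>2) < degree (tX * d\<^sup>2)") simp_all
    then show ?thesis by (simp add: degree_square)
  qed
qed

lemma cartier_0 [simp]: "cartier 0 = 0"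
  by (rule cartier_eqI[of _ _ 0]) simp

section \<open>Counting polynomials by degree\<close>

lemma polys_degree_le_Suc:
  "{p :: bit poly. degree p \<le> Suc n} = (\<lambda>(a, p). pCons a p) ` (UNIV \<times> {p. degree p \<le> n})"
proof (intro equalityI subsetI)
  fix p :: "bit poly" assume "p \<in> {p. degree p \<le> Suc n}"
  then show "p \<in> (\<lambda>(a, p). pCons a p) ` (UNIV \<times> {p. degree p \<le> n})"
    by (cases p) (auto simp: degree_pCons_eq_if split: if_splits)
next
  fix p :: "bit poly" assume "p \<in> (\<lambda>(a, p). pCons a p) ` (UNIV \<times> {p. degree p \<le> n})"
  then show "p \<in> {p. degree p \<le> Suc n}"
    by (auto simp: degree_pCons_eq_if)
qed

lemma UNIV_bit: "(UNIV :: bit set) = {0, 1}"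
  by (auto intro: bit.exhaust)

lemma polys_degree_le_0: "{p :: bit poly. degree p \<le> 0} = {0, 1}"
  using bit_poly_degree_0 by auto

lemma finite_polys_degree_le [simp]: "finite {p :: bit poly. degree p \<le> n}"
proof (induction n)
  case 0
  show ?case unfolding polys_degree_le_0 by simp
next
  case (Suc n)
  then show ?case unfolding polys_degree_le_Suc by (simp add: UNIV_bit)
qed

lemma card_polys_degree_le: "card {p :: bit poly. degree p \<le> n} = 2 ^ Suc n"
proof (induction n)
  case 0
  show ?case unfolding polys_degree_le_0 by simp
next
  case (Suc n)
  have "inj_on (\<lambda>(a, p). pCons a p) (UNIV \<times> {p :: bit poly. degree p \<le> n})"
    by (auto simp: inj_on_def)
  then show ?case
    unfolding polys_degree_le_Suc using Suc by (simp add: card_image UNIV_bit)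
qed

definition polys :: "nat \<Rightarrow> bit poly set" where
  "polys k = {b. b \<noteq> 0 \<and> degree b = k}"

lemma finite_polys [simp]: "finite (polys k)"
  by (rule finite_subset[OF _ finite_polys_degree_le[of k]]) (auto simp: polys_def)

lemma card_polys: "card (polys k) = 2 ^ k"
proof (cases k)
  case 0
  have "polys k = {1}" using bit_poly_degree_0 0 by (auto simp: polys_def)
  then show ?thesis using 0 by simp
next
  case (Suc n)
  have "{p :: bit poly. degree p \<le> k} = {p. degree p \<le> n} \<union> polys k"
    using Suc by (auto simp: polys_def)
  moreover have "{p. degree p \<le> n} \<inter> polys k = {}" using Suc by (auto simp: polys_def)
  ultimately have "card {p :: bit poly. degree p \<le> k} = card {p :: bit poly. degree p \<le> n} + card (polys k)"
    by (simp add: card_Un_disjoint)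
  then show ?thesis using Suc by (simp add: card_polys_degree_le)
qed

lemma card_polys_multiples:
  assumes "q \<noteq> 0"
  shows "card {b \<in> polys k. q dvd b} = (if degree q \<le> k then 2 ^ (k - degree q) else 0)"
proof (cases "degree q \<le> k")
  case True
  have "{b \<in> polys k. q dvd b} = (*) q ` polys (k - degree q)"
  proof (intro equalityI subsetI)
    fix b assume b: "b \<in> {b \<in> polys k. q dvd b}"
    then obtain c where c: "b = q * c" by (auto elim: dvdE)
    with b have "c \<in> polys (k - degree q)" using assms by (auto simp: polys_def degree_mult_eq)
    then show "b \<in> (*) q ` polys (k - degree q)" using c by blast
  next
    fix b assume "b \<in> (*) q ` polys (k - degree q)"
    then show "b \<in> {b \<in> polys k. q dvd b}"
      using assms True by (auto simp: polys_def degree_mult_eq)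
  qed
  moreover have "inj_on ((*) q) (polys (k - degree q))" using assms by (simp add: inj_on_def)
  ultimately show ?thesis using True by (simp add: card_image card_polys)
next
  case False
  then have "{b \<in> polys k. q dvd b} = {}"
    by (auto simp: polys_def dest: dvd_imp_degree_le)
  then show ?thesis using False by simp
qed

section \<open>Fractions in \<open>K\<close>\<close>

lemma tK_eq: "tK = to_fract tX"
  by (simp add: tK_def tX_def)

lemma K_cases: obtains a b :: "bit poly" where "y = to_fract a / to_fract b" "b \<noteq> 0"
  by (cases y) (auto simp: to_fract_def)

lemma K_coprime_cases:
  obtains a b :: "bit poly" where "y = to_fract a / to_fract b" "b \<noteq> 0" "coprime a b"
proof -
  obtain a b where ab: "y = to_fract a / to_fract b" "b \<noteq> 0" by (rule K_cases)
  obtain a' where a': "a = gcd a b * a'" by (meson dvdE gcd_dvd1)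
  obtain b' where b': "b = gcd a b * b'" by (meson dvdE gcd_dvd2)
  have g: "gcd a b \<noteq> 0" using ab by simp
  have "coprime a' b'"
    using gcd_coprime[of a b a' b'] g a' b' by (simp add: mult.commute)
  moreover have "b' \<noteq> 0" using b' ab by auto
  moreover have "y = to_fract a' / to_fract b'"
  proof -
    have "y = to_fract (gcd a b * a') / to_fract (gcd a b * b')" using a' b' ab by simp
    moreover have "to_fract (gcd a b) \<noteq> 0" using g unfolding to_fract_eq_0_iff .
    ultimately show ?thesis using mult_divide_mult_cancel_left by (simp only: to_fract_mult)
  qed
  ultimately show thesis using that by blast
qed

text \<open>By uniqueness of the square decomposition, 1 and t are linearly independent over the
  subfield of squares.\<close>

lemma square_eq_tK_square: "p\<^sup>2 = tK * q\<^sup>2 \<Longrightarrow> p = 0 \<and> q = 0" for p q :: K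
proof -
  assume eq: "p\<^sup>2 = tK * q\<^sup>2"
  obtain a b where p: "p = to_fract a / to_fract b" and b: "b \<noteq> 0" by (rule K_cases)
  obtain c d where q: "q = to_fract c / to_fract d" and d: "d \<noteq> 0" by (rule K_cases)
  have "(to_fract (a * d))\<^sup>2 = tK * (to_fract (c * b))\<^sup>2"
    using eq b d by (simp add: p q field_simps power2_eq_square)
  then have "to_fract ((a * d)\<^sup>2) = to_fract (tX * (c * b)\<^sup>2)"
    by (simp add: tK_eq power2_eq_square)
  then have "(a * d)\<^sup>2 = tX * (c * b)\<^sup>2" by (simp only: to_fract_eq_iff)
  then have "(a * d)\<^sup>2 + tX * 0\<^sup>2 = 0\<^sup>2 + tX * (c * b)\<^sup>2" by simp
  from square_decomposition_unique[OF this] show ?thesis using b d by (simp add: p q)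
qed

section \<open>The additive group of good parameters\<close>

text \<open>The group \<open>S\<close> of the overview.\<close>

definition normset :: "K set" where
  "normset = {y. \<exists>u v. y = u\<^sup>2 + u + tK * v\<^sup>2}"

text \<open>A point with \<open>x1 = 0\<close> would satisfy \<open>x0^2 = tK * x2^2\<close> and
  hence be zero, so \<open>x1\<close> can be scaled to 1; solving for \<open>y\<close> gives the
  parametrisation.\<close>

lemma conic_has_point_iff: "conic_has_point y \<longleftrightarrow> y \<in> normset"
proof
  assume "conic_has_point y"
  then obtain x0 x1 x2 where x: "(x0, x1, x2) \<noteq> (0, 0, 0)"
    and eq: "x0^2 + x0 * x1 + y * x1^2 = tK * x2^2" by (auto simp: conic_has_point_def)
  have "x1 \<noteq> 0"
    using square_eq_tK_square[of x0 x2] x eq by auto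
  then have "(x0/x1)\<^sup>2 + x0/x1 + y = tK * (x2/x1)\<^sup>2"
    using eq by (simp add: field_simps power2_eq_square)
  then have "y = (x0/x1)\<^sup>2 + x0/x1 + tK * (x2/x1)\<^sup>2"
    by (metis K_add_self add.assoc add.commute add_0)
  then show "y \<in> normset" unfolding normset_def by blast
next
  assume "y \<in> normset"
  then obtain u v where y: "y = u\<^sup>2 + u + tK * v\<^sup>2" by (auto simp: normset_def)
  have "u\<^sup>2 + u * 1 + y * 1\<^sup>2 = (u\<^sup>2 + u\<^sup>2) + (u + u) + tK * v\<^sup>2"
    unfolding y by (simp only: power_one mult_1_right add_ac)
  then have "u\<^sup>2 + u * 1 + y * 1\<^sup>2 = tK * v\<^sup>2" by simp
  moreover have "(u, 1 :: K, v) \<noteq> (0, 0, 0)" by simp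
  ultimately show "conic_has_point y" unfolding conic_has_point_def by blast
qed

text \<open>The operator \<open>1 + C\<close> of the overview, acting on numerators over the fixed
  denominator \<open>b\<close>.\<close>

definition one_plus_cartier :: "bit poly \<Rightarrow> bit poly \<Rightarrow> bit poly" where
  "one_plus_cartier b a = a + cartier (a * b)"

lemma one_plus_cartier_add: "one_plus_cartier b (x + y) = one_plus_cartier b x + one_plus_cartier b y"
  by (simp add: one_plus_cartier_def distrib_right cartier_add add_ac)

lemma fract_cartier_decomposition:
  assumes "b \<noteq> 0"
  obtains v where "to_fract a / to_fract b = (to_fract (cartier (a * b)) / to_fract b)\<^sup>2 + tK * v\<^sup>2"
proof -
  obtain d where d: "a * b = (cartier (a * b))\<^sup>2 + tX * d\<^sup>2" by (rule cartier_decomposition)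
  have b0: "to_fract b \<noteq> 0" using assms unfolding to_fract_eq_0_iff .
  have "to_fract (a * b) = to_fract ((cartier (a * b))\<^sup>2 + tX * d\<^sup>2)" using d by (rule arg_cong)
  then have "to_fract a * to_fract b = (to_fract (cartier (a * b)))\<^sup>2 + tK * (to_fract d)\<^sup>2"
    by (simp only: to_fract_mult to_fract_add tK_eq power2_eq_square)
  then have "to_fract a / to_fract b = (to_fract (cartier (a * b)) / to_fract b)\<^sup>2 + tK * (to_fract d / to_fract b)\<^sup>2"
    using b0 by (simp add: field_simps power2_eq_square)
  then show thesis by (rule that)
qed

text \<open>With \<open>h = C (a/b)\<close> one has \<open>a/b = h^2 + t v^2\<close>, so adding
  \<open>h\<close> produces \<open>h^2 + h + t v^2\<close>.\<close>

lemma one_plus_cartier_in_normset: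
  assumes "b \<noteq> 0"
  shows "to_fract (one_plus_cartier b a) / to_fract b \<in> normset"
proof -
  obtain v where v: "to_fract a / to_fract b = (to_fract (cartier (a * b)) / to_fract b)\<^sup>2 + tK * v\<^sup>2"
    using fract_cartier_decomposition[OF assms] by blast
  have "to_fract (one_plus_cartier b a) / to_fract b = to_fract a / to_fract b + to_fract (cartier (a * b)) / to_fract b"
    by (simp add: one_plus_cartier_def add_divide_distrib)
  also have "\<dots> = (to_fract (cartier (a * b)) / to_fract b)\<^sup>2 + to_fract (cartier (a * b)) / to_fract b + tK * v\<^sup>2"
    unfolding v by (simp only: add_ac)
  finally show ?thesis unfolding normset_def by blast
qed

text \<open>Applying \<open>C\<close> to \<open>y = u^2 + u + t v^2\<close> gives
  \<open>C y = u + C u\<close>, because \<open>C (u^2 + t v^2) = u\<close>. So \<open>C y\<close>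
  lies in the image of \<open>1 + C\<close>, but \<open>u = r/s\<close> may have poles outside
  \<open>b\<close>.\<close>

lemma normset_imp_cartier_eq:
  assumes "b \<noteq> 0" "to_fract a / to_fract b \<in> normset"
  obtains r s where "coprime r s" "s \<noteq> 0" "cartier (a * b) * s = b * (r + cartier (r * s))"
proof -
  obtain u v where uv: "to_fract a / to_fract b = u\<^sup>2 + u + tK * v\<^sup>2"
    using assms by (auto simp: normset_def)
  obtain r s where u: "u = to_fract r / to_fract s" and s: "s \<noteq> 0" and rs: "coprime r s"
    by (rule K_coprime_cases)
  let ?g = "to_fract (cartier (a * b)) / to_fract b" and ?h = "to_fract (cartier (r * s)) / to_fract s"
  obtain w where w: "to_fract a / to_fract b = ?g\<^sup>2 + tK * w\<^sup>2" using fract_cartier_decomposition[OF assms(1)] by blast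
  obtain z where z: "u = ?h\<^sup>2 + tK * z\<^sup>2" using fract_cartier_decomposition[OF s] u by blast
  have "?g\<^sup>2 + tK * w\<^sup>2 = u\<^sup>2 + (?h\<^sup>2 + tK * z\<^sup>2) + tK * v\<^sup>2"
    using uv w z by metis
  \<comment> \<open>Terms added on both sides cancel in pairs and leave a square equal to t times a
    square.\<close>
  then have "?g\<^sup>2 + tK * w\<^sup>2 + (u\<^sup>2 + ?h\<^sup>2 + tK * w\<^sup>2) = u\<^sup>2 + (?h\<^sup>2 + tK * z\<^sup>2) + tK * v\<^sup>2 + (u\<^sup>2 + ?h\<^sup>2 + tK * w\<^sup>2)"
    by simp
  then have "(?g + (u + ?h))\<^sup>2 + (tK * w\<^sup>2 + tK * w\<^sup>2) = tK * (z + (v + w))\<^sup>2 + (u\<^sup>2 + u\<^sup>2) + (?h\<^sup>2 + ?h\<^sup>2)"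
    unfolding K_square_add by (simp only: distrib_left add_ac)
  then have "(?g + (u + ?h))\<^sup>2 = tK * (z + (v + w))\<^sup>2"
    by (simp only: K_add_self add_0_right)
  then have "?g = u + ?h"
    using square_eq_tK_square K_add_eq_0_iff by blast
  then have "to_fract (cartier (a * b)) * to_fract s = to_fract b * (to_fract r + to_fract (cartier (r * s)))"
    using assms s u by (simp add: field_simps)
  then have "to_fract (cartier (a * b) * s) = to_fract (b * (r + cartier (r * s)))" by (simp only: to_fract_mult to_fract_add)
  then show thesis using that[OF rs s] by (simp only: to_fract_eq_iff)
qed

text \<open>Since \<open>t f'/f = t f f' / f^2\<close>, this says that \<open>C\<close> fixes
  logarithmic derivatives.\<close>

lemma cartier_tX_mult_pderiv: "cartier (tX * (f * pderiv f)) = tX * pderiv f"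
proof -
  obtain d where d: "f = (cartier f)\<^sup>2 + tX * d\<^sup>2" by (rule cartier_decomposition)
  have d': "pderiv f = d\<^sup>2" using arg_cong[OF d, of pderiv] by (simp only: pderiv_square_decomposition)
  have "tX * (f * pderiv f) = tX * (((cartier f)\<^sup>2 + tX * d\<^sup>2) * d\<^sup>2)" using d d' by simp
  also have "\<dots> = (tX * d\<^sup>2)\<^sup>2 + tX * (cartier f * d)\<^sup>2"
    by (simp add: power2_eq_square algebra_simps)
  finally show ?thesis unfolding d' by (rule cartier_eqI)
qed

text \<open>If \<open>p = w^2 q\<close>, then \<open>w\<close> divides
  \<open>pderiv p = d^2\<close>, hence \<open>d\<close>, and with it the remaining square.\<close>

lemma prime_square_dvd_imp_dvd_cartier:
  assumes "prime (w :: bit poly)" "w\<^sup>2 dvd p"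
  shows "w dvd cartier p"
proof -
  obtain d where d: "p = (cartier p)\<^sup>2 + tX * d\<^sup>2" by (rule cartier_decomposition)
  have d': "pderiv p = d\<^sup>2" using arg_cong[OF d, of pderiv] by (simp only: pderiv_square_decomposition)
  obtain q where "p = w\<^sup>2 * q" using assms by (auto elim: dvdE)
  then have "pderiv p = w\<^sup>2 * pderiv q" by (simp add: pderiv_mult pderiv_square)
  then have "w dvd d\<^sup>2" unfolding d' power2_eq_square[of w] by (simp add: mult.assoc)
  then have "w dvd d" using assms prime_dvd_power by blast
  then have "w dvd tX * d\<^sup>2" by (simp add: power2_eq_square)
  moreover have "w dvd p" using assms by (metis dvd_mult_left power2_eq_square)
  ultimately have "w dvd (cartier p)\<^sup>2" using d dvd_add_left_iff[of w "tX * d\<^sup>2" "(cartier p)\<^sup>2"] by metis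
  then show ?thesis using assms prime_dvd_power by blast
qed

text \<open>The fraction \<open>u = r / s\<close> may have simple poles outside \<open>b\<close>. The factor \<open>f\<close> collects
  them, and adding the logarithmic derivative \<open>t f' / f\<close>, which the Cartier operator fixes, removes them.\<close>
lemma one_plus_cartier_preimage:
  assumes rs: "coprime r s" and "s \<noteq> 0" and eq: "g * s = b * (r + cartier (r * s))"
  obtains a where "one_plus_cartier b a = g"
proof -
  define c where "c = cartier (r * s)"
  obtain d where d: "r * s = c\<^sup>2 + tX * d\<^sup>2" unfolding c_def by (rule cartier_decomposition)
  have d': "pderiv (r * s) = d\<^sup>2" using arg_cong[OF d, of pderiv] by (simp only: pderiv_square_decomposition)
  \<comment> \<open>\<open>(r + c) / s\<close> is \<open>(1 + C) (r/s)\<close>, so \<open>f\<close>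
    is exactly what cancels when that fraction is reduced.\<close>
  define f where "f = gcd s (r + c)"
  have f0: "f \<noteq> 0" using assms by (simp add: f_def)
  have fs: "f dvd s" and frc: "f dvd r + c" by (simp_all add: f_def)
  from fs obtain s2 where s2: "s = f * s2" by (auto elim: dvdE)
  have s20: "s2 \<noteq> 0" using s2 assms by auto
  \<comment> \<open>The cancelled poles are simple: a prime dividing \<open>f\<close> and
    \<open>s2\<close> has its square dividing \<open>s\<close>, so it divides \<open>c\<close> and
    therefore \<open>r\<close>, against \<open>coprime r s\<close>.\<close>
  have cop: "coprime f s2"
  proof (rule ccontr)
    assume "\<not> coprime f s2"
    then have "\<not> is_unit (gcd f s2)" unfolding is_unit_gcd .
    moreover have "gcd f s2 \<noteq> 0" using f0 by simp
    ultimately obtain w where w: "w dvd gcd f s2" "prime w" using prime_divisor_exists by blast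
    then have wf: "w dvd f" "w dvd s2" by simp_all
    then have "w\<^sup>2 dvd r * s" unfolding s2 power2_eq_square by (intro dvd_mult mult_dvd_mono)
    then have "w dvd c" unfolding c_def using w(2) by (intro prime_square_dvd_imp_dvd_cartier)
    moreover have "w dvd r + c" using wf frc dvd_trans by blast
    ultimately have "w dvd r" using dvd_add_left_iff by blast
    moreover have "w dvd s" using wf s2 by simp
    ultimately show False using rs w(2) by (meson coprime_def not_prime_unit)
  qed
  have "c\<^sup>2 = r * s + tX * d\<^sup>2" using d by (simp add: add.assoc)
  also have "\<dots> = r * s + tX * (r * pderiv s + s * pderiv r)" unfolding d'[symmetric] pderiv_mult ..
  finally have c2: "c\<^sup>2 = r * s + tX * (r * pderiv s + s * pderiv r)" .
  \<comment> \<open>Modulo \<open>f\<close> this identity makes \<open>r * (r + t s')\<close>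
    vanish. As \<open>r\<close> is prime to \<open>f\<close>, it is then congruent to
    \<open>t s'\<close>, and so to \<open>t f' s2\<close>.\<close>
  have "r * (r + tX * pderiv s) = (r + c)\<^sup>2 + (c\<^sup>2 + tX * (r * pderiv s))"
    unfolding bit_poly_square_add by (simp add: algebra_simps power2_eq_square)
  also have "c\<^sup>2 + tX * (r * pderiv s) = s * (r + tX * pderiv r)"
    unfolding c2 by (simp add: algebra_simps)
  finally have "r * (r + tX * pderiv s) = (r + c)\<^sup>2 + s * (r + tX * pderiv r)" .
  then have "f dvd r * (r + tX * pderiv s)" using fs frc by (simp add: power2_eq_square)
  moreover have "coprime f r" using rs s2 by (simp add: coprime_commute)
  ultimately have "f dvd r + tX * pderiv s" by (simp add: coprime_dvd_mult_right_iff)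
  moreover have "r + tX * pderiv s = (r + tX * (pderiv f * s2)) + f * (tX * pderiv s2)"
    unfolding s2 pderiv_mult by (simp add: algebra_simps)
  ultimately have "f dvd r + tX * (pderiv f * s2)" by (metis dvd_add_left_iff dvd_triv_left)
  \<comment> \<open>In terms of fractions \<open>r2/s2 = r/s + t f'/f\<close>: the poles in
    \<open>f\<close> are gone.\<close>
  then obtain r2 where r2: "r + tX * (pderiv f * s2) = f * r2" by (auto elim: dvdE)
  define k where "k = r2 + cartier (r2 * s2)"
  have "f * cartier (r2 * s2) = cartier (f\<^sup>2 * (r2 * s2))" by (simp add: cartier_square_mult)
  also have "f\<^sup>2 * (r2 * s2) = (f * r2) * (f * s2)" by (simp add: power2_eq_square algebra_simps)
  also have "\<dots> = r * s + s2\<^sup>2 * (tX * (f * pderiv f))"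
    unfolding r2[symmetric] s2 by (simp add: power2_eq_square algebra_simps)
  finally have e: "f * cartier (r2 * s2) = c + s2 * (tX * pderiv f)"
    by (simp add: cartier_add cartier_square_mult cartier_tX_mult_pderiv c_def)
  \<comment> \<open>\<open>1 + C\<close> kills \<open>t f'/f\<close>, so \<open>r2/s2\<close> and
    \<open>r/s\<close> have the same image.\<close>
  have fk: "f * k = r + c"
    unfolding k_def distrib_left e r2[symmetric] by (simp add: algebra_simps)
  have "f * (g * s2) = f * (b * k)"
    using eq fk unfolding c_def[symmetric] by (simp add: s2 algebra_simps)
  then have gk: "g * s2 = b * k" using f0 by simp
  \<comment> \<open>All cancellation was absorbed by \<open>f\<close>, so \<open>k/s2\<close> is
    reduced and its denominator must divide \<open>b\<close>.\<close>
  have "coprime s2 k"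
  proof (rule coprimeI)
    fix h assume h: "h dvd s2" "h dvd k"
    then have "h dvd r + c" "h dvd s" using fk s2 by (metis dvd_mult, simp)
    then have "h dvd f" by (simp add: f_def)
    with h cop show "is_unit h" by (meson coprime_def)
  qed
  moreover have "s2 dvd b * k" using gk by (metis dvd_triv_right)
  ultimately have "s2 dvd b" by (simp add: coprime_dvd_mult_left_iff)
  then obtain b2 where b2: "b = s2 * b2" by (auto elim: dvdE)
  \<comment> \<open>\<open>r2 * b2\<close> is the numerator of \<open>r2/s2\<close> over the
    denominator \<open>b\<close>.\<close>
  have "cartier (r2 * b2 * b) = cartier (b2\<^sup>2 * (r2 * s2))"
    by (simp add: b2 power2_eq_square mult_ac)
  then have "one_plus_cartier b (r2 * b2) = b2 * k"
    unfolding one_plus_cartier_def k_def cartier_square_mult by (simp add: algebra_simps)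
  moreover have "s2 * (b2 * k) = s2 * g" using gk unfolding b2 by (simp only: mult_ac)
  ultimately have "one_plus_cartier b (r2 * b2) = g" using s20 by simp
  then show thesis by (rule that)
qed

lemma degree_one_plus_cartier_le: "degree a \<le> M \<Longrightarrow> degree b \<le> M \<Longrightarrow> degree (one_plus_cartier b a) \<le> M"
  unfolding one_plus_cartier_def using degree_cartier_le[of "a * b"] degree_mult_le[of a b]
  by (intro degree_add_le) auto

text \<open>If the degree of \<open>a\<close> exceeded \<open>M\<close>, then
  \<open>cartier (a * b)\<close> would have smaller degree than \<open>a\<close>, and the leading
  term of \<open>a\<close> would survive under \<open>1 + C\<close>.\<close>

lemma degree_le_of_one_plus_cartier:
  assumes "degree (one_plus_cartier b a) \<le> M" "degree b \<le> M"
  shows "degree a \<le> M"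
proof (rule ccontr)
  assume "\<not> degree a \<le> M"
  then have "degree (cartier (a * b)) < degree a"
    using degree_cartier_le[of "a * b"] degree_mult_le[of a b] assms by linarith
  then have "degree (one_plus_cartier b a) = degree a" unfolding one_plus_cartier_def by (rule degree_add_eq_left)
  then show False using assms \<open>\<not> degree a \<le> M\<close> by simp
qed

text \<open>If \<open>a/b\<close> lies in \<open>S\<close>, some \<open>a'\<close> over
  \<open>b\<close> satisfies \<open>(1 + C) a' = C a\<close>, whence
  \<open>(1 + C) (a + a') = a + C a + C a = a\<close>.\<close>

lemma normset_eq_one_plus_cartier_image:
  assumes "b \<noteq> 0" "degree b \<le> M"
  shows "{a. degree a \<le> M \<and> to_fract a / to_fract b \<in> normset} = one_plus_cartier b ` {a. degree a \<le> M}"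
proof (intro equalityI subsetI)
  fix a assume "a \<in> {a. degree a \<le> M \<and> to_fract a / to_fract b \<in> normset}"
  then have a: "degree a \<le> M" "to_fract a / to_fract b \<in> normset" by simp_all
  obtain r s where rs: "coprime r s" "s \<noteq> 0" "cartier (a * b) * s = b * (r + cartier (r * s))"
    using normset_imp_cartier_eq[OF assms(1) a(2)] by blast
  obtain a' where a': "one_plus_cartier b a' = cartier (a * b)" using one_plus_cartier_preimage[OF rs] by blast
  have "degree (cartier (a * b)) \<le> M"
    using degree_cartier_le[of "a * b"] degree_mult_le[of a b] a assms by linarith
  then have "degree a' \<le> M" using degree_le_of_one_plus_cartier[of b a' M] a' assms by simp
  moreover have "one_plus_cartier b (a + a') = a" unfolding one_plus_cartier_add a' by (simp add: one_plus_cartier_def add.assoc)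
  ultimately show "a \<in> one_plus_cartier b ` {a. degree a \<le> M}"
    using a by (metis (mono_tags) degree_add_le image_eqI mem_Collect_eq)
qed (use assms one_plus_cartier_in_normset degree_one_plus_cartier_le in auto)

section \<open>Fixed points of the Cartier operator\<close>

text \<open>Logarithmic derivatives ignore square factors of \<open>f\<close>, and a factor t merely
  adds 1, which the flag in \<open>log_deriv\<close> records; these divisors are the remaining
  choices.\<close>

definition sqfree_divisors :: "bit poly \<Rightarrow> bit poly set" where
  "sqfree_divisors b = {f. f dvd b \<and> squarefree f \<and> \<not> tX dvd f}"

lemma prime_tX: "prime tX"
proof -
  have "irreducible tX"
  proof (rule irreducibleI)
    show "tX \<noteq> 0" "\<not> is_unit tX" by (auto simp: tX_def is_unit_iff_degree)
    fix a b assume "tX = a * b"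
    moreover have "degree tX = 1" "tX \<noteq> 0" by (simp_all add: tX_def)
    ultimately have "degree (a * b) = 1" "a \<noteq> 0" "b \<noteq> 0" by auto
    then have "degree a = 0 \<or> degree b = 0" by (auto simp: degree_mult_eq)
    then show "is_unit a \<or> is_unit b" using \<open>a \<noteq> 0\<close> \<open>b \<noteq> 0\<close>
      using bit_poly_degree_0[of a] bit_poly_degree_0[of b] by auto
  qed
  then show ?thesis by (simp add: prime_iff_irreducible)
qed

lemma degree_tX [simp]: "degree tX = 1"
  by (simp add: tX_def)

lemma tX_neq_0 [simp]: "tX \<noteq> 0"
  by (simp add: tX_def)

lemma degree_pderiv_le: "degree (pderiv (p :: bit poly)) \<le> degree p - 1"
proof (rule degree_le, intro allI impI)
  fix i assume "degree p - 1 < i"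
  then have "coeff p (Suc i) = 0" by (intro coeff_eq_0) linarith
  then show "coeff (pderiv p) i = 0" by (simp add: coeff_pderiv)
qed

text \<open>A polynomial with zero derivative is a square, and a prime is not.\<close>

lemma pderiv_prime_neq_0:
  assumes "prime (w :: bit poly)"
  shows "pderiv w \<noteq> 0"
proof
  assume "pderiv w = 0"
  moreover obtain d where d: "w = (cartier w)\<^sup>2 + tX * d\<^sup>2" by (rule cartier_decomposition)
  moreover have "pderiv w = d\<^sup>2" using arg_cong[OF d, of pderiv] by (simp only: pderiv_square_decomposition)
  ultimately have "w = (cartier w)\<^sup>2" by simp
  then have w: "(cartier w)\<^sup>2 = w" by simp
  then have "(cartier w)\<^sup>2 dvd w" by simp
  then have "is_unit (cartier w)" using squarefree_prime[OF assms] squarefreeD by blast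
  then have "w = 1" using w by (simp add: bit_poly_is_unit_iff)
  then show False using assms by simp
qed

text \<open>A prime \<open>w\<close> dividing \<open>f = w * h\<close> and its derivative would
  divide \<open>h * pderiv w\<close>. As \<open>pderiv w\<close> is nonzero of smaller degree,
  \<open>w\<close> would divide \<open>h\<close>.\<close>

lemma coprime_pderiv_squarefree:
  assumes "squarefree (f :: bit poly)"
  shows "coprime f (pderiv f)"
proof (rule ccontr)
  have "f \<noteq> 0" using assms by auto
  assume "\<not> coprime f (pderiv f)"
  then have "\<not> is_unit (gcd f (pderiv f))" unfolding is_unit_gcd .
  moreover have "gcd f (pderiv f) \<noteq> 0" using \<open>f \<noteq> 0\<close> by simp
  ultimately obtain w where "w dvd gcd f (pderiv f)" and pw: "prime w" using prime_divisor_exists by blast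
  then have w: "w dvd f" "w dvd pderiv f" by simp_all
  from w(1) obtain h where h: "f = w * h" by (auto elim: dvdE)
  then have "w dvd w * pderiv h + h * pderiv w" using w by (simp add: pderiv_mult)
  then have "w dvd h * pderiv w" by (simp add: dvd_add_right_iff)
  moreover have "\<not> w dvd pderiv w"
  proof
    assume "w dvd pderiv w"
    then have "degree w \<le> degree (pderiv w)" using pderiv_prime_neq_0[OF pw] by (simp add: dvd_imp_degree_le)
    moreover have "degree (pderiv w) \<le> degree w - 1" by (rule degree_pderiv_le)
    ultimately show False using prime_degree_pos[OF pw] by simp
  qed
  ultimately have "w dvd h" using pw by (simp add: prime_dvd_mult_iff)
  then have "w\<^sup>2 dvd f" unfolding h power2_eq_square by (intro mult_dvd_mono) simp_all
  then have "is_unit w" using assms squarefreeD by blast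
  then show False using pw not_prime_unit by blast
qed

text \<open>The fraction behind \<open>log_deriv\<close> is in lowest terms, so \<open>f\<close> can
  be recovered as its denominator.\<close>

lemma coprime_log_deriv:
  assumes "squarefree f" "\<not> tX dvd f"
  shows "coprime f (tX * pderiv f + (if e then f else 0))"
proof -
  have "coprime tX f" using assms prime_tX by (simp add: prime_imp_coprime)
  then have "coprime f (tX * pderiv f)"
    using coprime_pderiv_squarefree[OF assms(1)] by (simp add: coprime_commute)
  moreover have "coprime f (tX * pderiv f + f)"
  proof (rule coprimeI)
    fix h assume h: "h dvd f" "h dvd tX * pderiv f + f"
    then have "h dvd tX * pderiv f" using dvd_add_left_iff by blast
    with h(1) \<open>coprime f (tX * pderiv f)\<close> show "is_unit h" by (meson coprime_def)
  qed
  ultimately show ?thesis by simp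
qed

text \<open>The numerator over \<open>b\<close> of \<open>t g'/g\<close>, where \<open>g = t f\<close> if \<open>e\<close> holds and \<open>g = f\<close> otherwise.\<close>
definition log_deriv :: "bit poly \<Rightarrow> bool \<times> bit poly \<Rightarrow> bit poly" where
  "log_deriv b = (\<lambda>(e, f). (tX * pderiv f + (if e then f else 0)) * (b div f))"

lemma sqfree_divisors_neq_0: "f \<in> sqfree_divisors b \<Longrightarrow> f \<noteq> 0"
  by (auto simp: sqfree_divisors_def)

text \<open>With \<open>b = f * h\<close> the factor \<open>h^2\<close> comes out, and the summands
  \<open>t f f'\<close> and \<open>f^2\<close> map to \<open>t f'\<close> and
  \<open>f\<close>.\<close>

lemma cartier_log_deriv:
  assumes "f dvd b" "f \<noteq> 0"
  shows "cartier (log_deriv b (e, f) * b) = log_deriv b (e, f)"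
proof -
  obtain h where h: "b = f * h" using assms by (auto elim: dvdE)
  have "log_deriv b (e, f) * b = h\<^sup>2 * (tX * (f * pderiv f) + f\<^sup>2 * (if e then 1 else 0))"
    using assms by (simp add: h log_deriv_def power2_eq_square algebra_simps)
  moreover have "cartier 1 = 1" by (rule cartier_eqI[of _ _ 0]) simp
  ultimately show ?thesis
    unfolding h log_deriv_def using assms
    by (simp only: cartier_square_mult cartier_add cartier_tX_mult_pderiv) (simp add: algebra_simps)
qed

lemma degree_log_deriv_le:
  assumes "f dvd b" "f \<noteq> 0" "b \<noteq> 0"
  shows "degree (log_deriv b (e, f)) \<le> degree b"
proof -
  obtain h where h: "b = f * h" using assms by (auto elim: dvdE)
  have "degree (tX * pderiv f) \<le> degree f"
  proof (cases "pderiv f = 0")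
    case False
    \<comment> \<open>A nonzero derivative forces positive degree, so the \<open>- 1\<close> in
      \<open>degree_pderiv_le\<close> is a true subtraction and offsets the factor t.\<close>
    then have "degree f \<noteq> 0" by (cases "degree f = 0") (auto elim!: degree_eq_zeroE)
    then show ?thesis
      using degree_pderiv_le[of f] False by (subst degree_tX_mult) auto
  qed simp
  then have "degree (tX * pderiv f + (if e then f else 0)) \<le> degree f"
    by (intro degree_add_le) auto
  then have "degree ((tX * pderiv f + (if e then f else 0)) * h) \<le> degree f + degree h"
    using degree_mult_le le_trans add_le_mono1 by blast
  moreover have "degree b = degree f + degree h" using h assms by (simp add: degree_mult_eq)
  ultimately show ?thesis using assms by (simp add: log_deriv_def h)
qed

text \<open>Equal values are equal fractions over \<open>b\<close>; comparing lowest terms gives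
  \<open>f = f'\<close>, and then the presence of the summand \<open>f\<close> determines the
  flag.\<close>

lemma inj_on_log_deriv:
  assumes "b \<noteq> 0"
  shows "inj_on (log_deriv b) (UNIV \<times> sqfree_divisors b)"
proof (rule inj_onI, clarsimp)
  fix e e' f f'
  assume f: "f \<in> sqfree_divisors b" "f' \<in> sqfree_divisors b"
    and eq: "log_deriv b (e, f) = log_deriv b (e', f')"
  let ?u = "tX * pderiv f + (if e then f else 0)" and ?u' = "tX * pderiv f' + (if e' then f' else 0)"
  have "?u * (b div f) * (f * f') = ?u' * (b div f') * (f * f')"
    using eq by (simp add: log_deriv_def)
  then have "(?u * f') * ((b div f) * f) = (?u' * f) * ((b div f') * f')" by (simp only: mult_ac)
  moreover have "(b div f) * f = b" "(b div f') * f' = b" using f by (simp_all add: sqfree_divisors_def)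
  ultimately have "(?u * f') * b = (?u' * f) * b" by (simp only:)
  then have uu: "?u * f' = ?u' * f" using assms by simp
  have "coprime f ?u" "coprime f' ?u'" using f coprime_log_deriv by (auto simp: sqfree_divisors_def)
  moreover have "f dvd ?u * f'" "f' dvd ?u' * f" using uu by (metis dvd_triv_right)+
  ultimately have "f dvd f'" "f' dvd f" by (simp_all only: coprime_dvd_mult_right_iff)
  then have ff: "f = f'" by (rule bit_poly_dvd_antisym)
  have "f \<noteq> 0" using f sqfree_divisors_neq_0 by blast
  then have "?u = ?u'" using uu unfolding ff by simp
  then have "e = e'" using \<open>f \<noteq> 0\<close> unfolding ff by (auto split: if_splits)
  then show "e = e' \<and> f = f'" using ff by simp
qed

text \<open>In lowest terms \<open>a0/b0\<close>, being fixed reads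
  \<open>a0^2 = a0 b0 + t (a0 b0)'\<close>. Hence \<open>b0\<close> divides
  \<open>a0 + t b0'\<close>, and by degrees the quotient is a constant, which becomes the
  flag.\<close>

lemma fixed_is_log_deriv:
  assumes b: "b \<noteq> 0" and fixed: "cartier (a * b) = a"
  shows "a \<in> log_deriv b ` (UNIV \<times> sqfree_divisors b)"
proof -
  define g where "g = gcd a b"
  have g: "g \<noteq> 0" using b by (simp add: g_def)
  obtain a0 where a0: "a = g * a0" unfolding g_def by (meson dvdE gcd_dvd1)
  obtain b0 where b0: "b = g * b0" unfolding g_def by (meson dvdE gcd_dvd2)
  have cop: "coprime a0 b0"
    using gcd_coprime[OF g[unfolded g_def] a0[unfolded g_def mult.commute[of "gcd a b"]]
        b0[unfolded g_def mult.commute[of "gcd a b"]]] .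
  have b00: "b0 \<noteq> 0" using b0 b by auto
  have "g * cartier (a0 * b0) = cartier (g\<^sup>2 * (a0 * b0))" by (simp add: cartier_square_mult)
  also have "g\<^sup>2 * (a0 * b0) = a * b" by (simp add: a0 b0 power2_eq_square mult_ac)
  finally have "g * cartier (a0 * b0) = g * a0" using fixed a0 by simp
  then have fix0: "cartier (a0 * b0) = a0" using g by simp
  obtain d where d: "a0 * b0 = a0\<^sup>2 + tX * d\<^sup>2" using cartier_decomposition[of "a0 * b0"] fix0 by metis
  have d': "pderiv (a0 * b0) = d\<^sup>2" using arg_cong[OF d, of pderiv] by (simp only: pderiv_square_decomposition)
  have "a0\<^sup>2 = a0 * b0 + tX * d\<^sup>2" unfolding d by (simp add: add.assoc)
  moreover have "d\<^sup>2 = a0 * pderiv b0 + b0 * pderiv a0" using d' by (simp only: pderiv_mult)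
  ultimately have sq: "a0\<^sup>2 = a0 * b0 + tX * (a0 * pderiv b0 + b0 * pderiv a0)" by (simp only:)
  have "a0 * (a0 + tX * pderiv b0) = b0 * (a0 + tX * pderiv a0)"
    unfolding distrib_left power2_eq_square[of a0, symmetric] sq by (simp add: algebra_simps)
  then have "b0 dvd a0 * (a0 + tX * pderiv b0)" by simp
  moreover have "coprime b0 a0" using cop by (simp add: coprime_commute)
  ultimately have "b0 dvd a0 + tX * pderiv b0" by (simp only: coprime_dvd_mult_right_iff)
  then obtain e where e: "a0 + tX * pderiv b0 = b0 * e" by (auto elim: dvdE)
  have "degree a0 \<le> degree b0" using degree_cartier_le[of "a0 * b0"] degree_mult_le[of a0 b0] fix0 by simp
  moreover have "degree (tX * pderiv b0) \<le> degree b0"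
    using degree_log_deriv_le[of b0 b0 False] b00 by (simp add: log_deriv_def)
  ultimately have "degree (b0 * e) \<le> degree b0" unfolding e[symmetric] by (intro degree_add_le)
  then have "degree e = 0" using b00 by (cases "e = 0") (simp_all add: degree_mult_eq)
  then have "e = 0 \<or> e = 1" by (rule bit_poly_degree_0)
  moreover have "a0 = tX * pderiv b0 + b0 * e" using e by (metis add.commute bit_poly_add_self_left)
  ultimately have a0': "a0 = tX * pderiv b0 + (if e = 1 then b0 else 0)" by auto
  \<comment> \<open>If \<open>w^2\<close> divides \<open>b0\<close>, it divides the derivative too,
    so \<open>w\<close> divides \<open>a0\<close>; a factor t of \<open>b0\<close> likewise divides
    \<open>a0 = t b0' + e b0\<close>. Both contradict lowest terms.\<close>
  have "squarefree b0"
  proof (rule squarefreeI)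
    fix w assume "w\<^sup>2 dvd b0"
    then obtain h where h: "b0 = w\<^sup>2 * h" by (auto elim: dvdE)
    then have "pderiv b0 = w\<^sup>2 * pderiv h" by (simp add: pderiv_mult pderiv_square)
    then have "w dvd a0" unfolding a0' h by (simp add: power2_eq_square)
    moreover have "w dvd b0" unfolding h by (simp add: power2_eq_square)
    ultimately show "is_unit w" using cop by (meson coprime_def)
  qed
  moreover have "\<not> tX dvd b0"
  proof
    assume t: "tX dvd b0"
    then have "tX dvd a0" unfolding a0' by simp
    then show False using t cop prime_tX by (meson coprime_def not_prime_unit)
  qed
  ultimately have "b0 \<in> sqfree_divisors b" unfolding sqfree_divisors_def b0 by simp
  moreover have "a = log_deriv b (e = 1, b0)"
    using b00 a0 a0' unfolding log_deriv_def b0 by (simp add: mult.commute)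
  ultimately show ?thesis by blast
qed

lemma card_fixed:
  assumes "b \<noteq> 0" "degree b \<le> M"
  shows "card {a. degree a \<le> M \<and> one_plus_cartier b a = 0} = 2 * card (sqfree_divisors b)"
proof -
  have "{a. degree a \<le> M \<and> one_plus_cartier b a = 0} = log_deriv b ` (UNIV \<times> sqfree_divisors b)"
  proof (intro equalityI subsetI)
    fix a assume "a \<in> {a. degree a \<le> M \<and> one_plus_cartier b a = 0}"
    then have "cartier (a * b) = a" by (simp add: one_plus_cartier_def bit_poly_add_eq_0_iff)
    then show "a \<in> log_deriv b ` (UNIV \<times> sqfree_divisors b)"
      using assms(1) by (intro fixed_is_log_deriv)
  next
    fix a assume "a \<in> log_deriv b ` (UNIV \<times> sqfree_divisors b)"
    then obtain e f where f: "f \<in> sqfree_divisors b" and a: "a = log_deriv b (e, f)" by blast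
    have f': "f dvd b" "f \<noteq> 0" using f sqfree_divisors_neq_0 by (auto simp: sqfree_divisors_def)
    show "a \<in> {a. degree a \<le> M \<and> one_plus_cartier b a = 0}"
      using cartier_log_deriv[OF f', of e] degree_log_deriv_le[OF f' assms(1), of e] assms(2)
      by (simp add: a one_plus_cartier_def)
  qed
  then show ?thesis
    using inj_on_log_deriv[OF assms(1)] by (simp add: card_image card_cartesian_product card_UNIV_bool)
qed

section \<open>The number of admissible numerators over a fixed denominator\<close>

lemma card_image_additive:
  fixes h :: "'a :: ab_group_add \<Rightarrow> 'b :: ab_group_add"
  assumes add: "\<And>x y. h (x + y) = h x + h y" and fin: "finite V"
    and V: "\<And>x y. x \<in> V \<Longrightarrow> y \<in> V \<Longrightarrow> x + y \<in> V" "\<And>x y. x \<in> V \<Longrightarrow> y \<in> V \<Longrightarrow> x - y \<in> V"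
  shows "card V = card (h ` V) * card {x \<in> V. h x = 0}"
proof -
  have diff: "h (x - y) = h x - h y" for x y
    using add[of "x - y" y] by (simp add: algebra_simps)
  have "card V = (\<Sum>x\<in>V. 1)" by simp
  also have "\<dots> = (\<Sum>y\<in>h ` V. \<Sum>x\<in>{x \<in> V. h x = y}. 1)" by (rule sum.image_gen) fact
  also have "\<dots> = (\<Sum>y\<in>h ` V. card {x \<in> V. h x = 0})"
  proof (rule sum.cong)
    fix y assume "y \<in> h ` V"
    then obtain x0 where x0: "x0 \<in> V" "h x0 = y" by blast
    have "{x \<in> V. h x = y} = (+) x0 ` {x \<in> V. h x = 0}"
    proof (intro equalityI subsetI)
      fix x assume "x \<in> {x \<in> V. h x = y}"
      then have "x - x0 \<in> {x \<in> V. h x = 0}" using x0 by (simp add: diff V)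
      moreover have "x = x0 + (x - x0)" by simp
      ultimately show "x \<in> (+) x0 ` {x \<in> V. h x = 0}" by (rule rev_image_eqI)
    qed (use x0 add V in auto)
    moreover have "inj_on ((+) x0) {x \<in> V. h x = 0}" by (simp add: inj_on_def)
    ultimately have "card {x \<in> V. h x = y} = card {x \<in> V. h x = 0}" by (simp add: card_image)
    then show "(\<Sum>x\<in>{x \<in> V. h x = y}. 1) = card {x \<in> V. h x = 0}" by simp
  qed simp
  also have "\<dots> = card (h ` V) * card {x \<in> V. h x = 0}" by simp
  finally show ?thesis .
qed

definition primes_off_t :: "bit poly \<Rightarrow> bit poly set" where
  "primes_off_t b = {p. prime p \<and> p \<noteq> tX \<and> p dvd b}"

lemma finite_divisors: "b \<noteq> 0 \<Longrightarrow> finite {p :: bit poly. p dvd b}"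
  by (rule finite_subset[OF _ finite_polys_degree_le[of "degree b"]]) (auto dest: dvd_imp_degree_le)

lemma finite_primes_off_t: "b \<noteq> 0 \<Longrightarrow> finite (primes_off_t b)"
  by (rule finite_subset[OF _ finite_divisors]) (auto simp: primes_off_t_def)

lemma prod_primes_dvd:
  assumes "finite I" "\<And>p. p \<in> I \<Longrightarrow> prime (p :: bit poly)"
  shows "\<Prod>I dvd b \<longleftrightarrow> (\<forall>p\<in>I. p dvd b)"
proof
  assume dvd: "\<Prod>I dvd b"
  show "\<forall>p\<in>I. p dvd b"
  proof
    fix p assume "p \<in> I"
    then have "p dvd \<Prod>I" by (rule dvd_prodI[OF assms(1), of _ "\<lambda>x. x"])
    then show "p dvd b" using dvd by (rule dvd_trans)
  qed
next
  assume all: "\<forall>p\<in>I. p dvd b"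
  from assms all show "\<Prod>I dvd b"
  proof (induction I rule: finite_induct)
    case (insert p I)
    have "coprime p (\<Prod>I)"
    proof (rule prod_coprime_right)
      fix q assume "q \<in> I"
      then show "coprime p q" using insert by (intro primes_coprime) auto
    qed
    then show ?case using insert by (simp add: divides_mult)
  qed simp
qed

lemma prime_dvd_prod_primes:
  assumes "finite I" "\<And>p. p \<in> I \<Longrightarrow> prime (p :: bit poly)" "prime q"
  shows "q dvd \<Prod>I \<longleftrightarrow> q \<in> I"
  using assms prime_dvd_prod_iff[of I q "\<lambda>x. x"] primes_dvd_imp_eq[of q] by auto

lemma squarefree_prod_primes:
  assumes "\<And>p. p \<in> I \<Longrightarrow> prime (p :: bit poly)"
  shows "squarefree (\<Prod>I)"
  by (intro squarefree_prod_coprime squarefree_prime primes_coprime assms)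

lemma squarefree_eqI:
  assumes "squarefree (f :: bit poly)" "squarefree g" "\<And>p. prime p \<Longrightarrow> p dvd f \<longleftrightarrow> p dvd g"
  shows "f = g"
proof -
  have "f \<noteq> 0" "g \<noteq> 0" using assms by auto
  have "multiplicity p f = multiplicity p g" if p: "prime p" for p
  proof -
    have "multiplicity p f \<le> 1" "multiplicity p g \<le> 1"
      using assms p squarefree_factorial_semiring'' \<open>f \<noteq> 0\<close> \<open>g \<noteq> 0\<close> by blast+
    moreover have "multiplicity p f > 0 \<longleftrightarrow> multiplicity p g > 0"
      using assms(3)[OF p] p \<open>f \<noteq> 0\<close> \<open>g \<noteq> 0\<close> by (simp add: prime_multiplicity_gt_zero_iff)
    ultimately show ?thesis by linarith
  qed
  then have "normalize f = normalize g"
    using \<open>f \<noteq> 0\<close> \<open>g \<noteq> 0\<close> multiplicity_eq_imp_eq by blast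
  then show ?thesis by simp
qed

text \<open>Sets of prime divisors other than t correspond to their products.\<close>

lemma card_sqfree_divisors:
  assumes "b \<noteq> 0"
  shows "card (sqfree_divisors b) = 2 ^ card (primes_off_t b)"
proof -
  have pr: "\<And>p. p \<in> I \<Longrightarrow> prime p" and fin: "finite I" if "I \<subseteq> primes_off_t b" for I
    using that finite_primes_off_t[OF assms] by (auto simp: primes_off_t_def intro: finite_subset)
  have "bij_betw (\<lambda>I. \<Prod>I) (Pow (primes_off_t b)) (sqfree_divisors b)"
  proof (rule bij_betwI')
    fix I J assume I: "I \<in> Pow (primes_off_t b)" and J: "J \<in> Pow (primes_off_t b)"
    have "I = J" if "\<Prod>I = \<Prod>J"
    proof -
      have "q \<in> I \<longleftrightarrow> q \<in> J" if "prime q" for q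
        using prime_dvd_prod_primes[of I q] prime_dvd_prod_primes[of J q] I J pr fin that
          \<open>\<Prod>I = \<Prod>J\<close> by (metis PowD)
      then show ?thesis using I J pr by blast
    qed
    then show "\<Prod>I = \<Prod>J \<longleftrightarrow> I = J" by blast
  next
    fix I assume I: "I \<in> Pow (primes_off_t b)"
    have "\<Prod>I dvd b" using prod_primes_dvd[of I b] I pr fin by (auto simp: primes_off_t_def)
    moreover have "tX \<notin> I" using I by (auto simp: primes_off_t_def)
    then have "\<not> tX dvd \<Prod>I" using prime_dvd_prod_primes[of I tX] prime_tX I pr fin by blast
    ultimately show "\<Prod>I \<in> sqfree_divisors b"
      using I pr by (auto simp: sqfree_divisors_def intro!: squarefree_prod_primes)
  next
    fix f assume f: "f \<in> sqfree_divisors b"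
    define I where "I = {p. prime p \<and> p dvd f}"
    have I: "I \<subseteq> primes_off_t b"
      using f by (auto simp: I_def primes_off_t_def sqfree_divisors_def intro: dvd_trans)
    have "f = \<Prod>I"
    proof (rule squarefree_eqI)
      show "squarefree f" using f by (simp add: sqfree_divisors_def)
      show "squarefree (\<Prod>I)" by (rule squarefree_prod_primes) (simp add: I_def)
      fix p :: "bit poly" assume "prime p"
      then have "p dvd \<Prod>I \<longleftrightarrow> p \<in> I" by (intro prime_dvd_prod_primes) (use I fin pr in blast)+
      then show "p dvd f \<longleftrightarrow> p dvd \<Prod>I" using \<open>prime p\<close> by (simp add: I_def)
    qed
    then show "\<exists>I\<in>Pow (primes_off_t b). f = \<Prod>I" using I by blast
  qed
  then have "card (Pow (primes_off_t b)) = card (sqfree_divisors b)" by (rule bij_betw_same_card)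
  then show ?thesis using finite_primes_off_t[OF assms] by (simp add: card_Pow)
qed

text \<open>Image size times kernel size is the size \<open>2^(M+1)\<close> of the whole space; the
  flag in the kernel accounts for the extra factor 2.\<close>

lemma card_normset_denominator:
  assumes "b \<noteq> 0" "degree b \<le> M"
  shows "card {a. degree a \<le> M \<and> to_fract a / to_fract b \<in> normset} * 2 ^ card (primes_off_t b) = 2 ^ M"
proof -
  let ?V = "{a :: bit poly. degree a \<le> M}"
  have "card ?V = card (one_plus_cartier b ` ?V) * card {x \<in> ?V. one_plus_cartier b x = 0}"
    by (rule card_image_additive) (auto simp: one_plus_cartier_add intro: degree_add_le)
  moreover have "{x \<in> ?V. one_plus_cartier b x = 0} = {a. degree a \<le> M \<and> one_plus_cartier b a = 0}" by auto
  ultimately have "2 * 2 ^ M = card (one_plus_cartier b ` ?V) * (2 * 2 ^ card (primes_off_t b))"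
    using card_fixed[OF assms] card_polys_degree_le[of M] by (simp add: card_sqfree_divisors[OF assms(1)])
  then show ?thesis unfolding normset_eq_one_plus_cartier_image[OF assms] by simp
qed

section \<open>Counting by height\<close>

lemma places_eq: "places = Fin ` {p. prime p} \<union> {Infty}"
proof -
  have "lead_coeff p = 1 \<and> irreducible p \<longleftrightarrow> prime p" for p :: "bit poly"
    using bit_poly_lead_coeff[of p] unfolding prime_iff_irreducible by (cases "p = 0") auto
  then show ?thesis unfolding places_def by auto
qed

lemma rep_spec: obtains c d where "rep y = (c, d)" "d \<noteq> 0" "y = to_fract c / to_fract d"
proof -
  obtain a b where "y = to_fract a / to_fract b" "b \<noteq> 0" by (rule K_cases)
  then have "\<exists>x. case x of (a, b) \<Rightarrow> b \<noteq> 0 \<and> y = Fract a b"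
    by (intro exI[of _ "(a, b)"]) (simp add: Fract_conv_to_fract)
  then have "case rep y of (a, b) \<Rightarrow> b \<noteq> 0 \<and> y = Fract a b"
    unfolding rep_def by (rule someI_ex)
  then show thesis using that by (cases "rep y") (simp add: Fract_conv_to_fract)
qed

lemma pmult_eq_multiplicity:
  assumes "prime p" "x \<noteq> 0"
  shows "pmult p x = multiplicity p x"
proof -
  have "p ^ k dvd x \<longleftrightarrow> k \<le> multiplicity p x" for k
    using assms by (intro power_dvd_iff_le_multiplicity) (auto dest: not_prime_unit)
  then show ?thesis unfolding pmult_def by (intro Greatest_equality) auto
qed

lemma fract_eq_iff_cross:
  assumes "b \<noteq> 0" "d \<noteq> (0 :: 'a :: idom)"
  shows "to_fract a / to_fract b = to_fract c / to_fract d \<longleftrightarrow> a * d = c * b"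
proof -
  have "to_fract a / to_fract b = to_fract c / to_fract d \<longleftrightarrow> to_fract a * to_fract d = to_fract c * to_fract b"
    using assms by (intro frac_eq_eq) simp_all
  also have "\<dots> \<longleftrightarrow> a * d = c * b" unfolding to_fract_mult[symmetric] by (rule to_fract_eq_iff)
  finally show ?thesis .
qed

text \<open>Two representations satisfy \<open>a * d = c * b\<close>; degrees and multiplicities are
  additive, so the arbitrary choice in \<open>rep\<close> does not matter.\<close>

lemma val_fract:
  assumes "a \<noteq> 0" "b \<noteq> 0" and y: "y = to_fract a / to_fract b"
  shows "prime p \<Longrightarrow> val (Fin p) y = int (multiplicity p a) - int (multiplicity p b)"
    and "val Infty y = int (degree b) - int (degree a)"
proof -
  obtain c d where r: "rep y = (c, d)" and d: "d \<noteq> 0" and y': "y = to_fract c / to_fract d"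
    by (rule rep_spec)
  have eq: "a * d = c * b" using y y' fract_eq_iff_cross[of b d a c] assms d by simp
  then have c: "c \<noteq> 0" using assms d by auto
  have "degree (a * d) = degree (c * b)" using eq by simp
  then show "val Infty y = int (degree b) - int (degree a)"
    using r assms c d by (simp add: degree_mult_eq)
  assume p: "prime p"
  have "multiplicity p (a * d) = multiplicity p (c * b)" using eq by simp
  then have "multiplicity p a + multiplicity p d = multiplicity p c + multiplicity p b"
    using p assms c d by (simp add: prime_elem_multiplicity_mult_distrib)
  then show "val (Fin p) y = int (multiplicity p a) - int (multiplicity p b)"
    using r p c d by (simp add: pmult_eq_multiplicity)
qed

lemma max_one_absval_Fin:
  assumes "coprime a b" "b \<noteq> 0" "prime p"
  shows "max 1 (absval (Fin p) (to_fract a / to_fract b)) = 2 ^ (degree p * multiplicity p b)"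
proof (cases "a = 0")
  case True
  \<comment> \<open>For \<open>a = 0\<close> coprimality forces \<open>b = 1\<close>, which fits the
    convention \<open>absval w 0 = 0\<close>.\<close>
  then have "b = 1" using assms by (simp add: bit_poly_is_unit_iff)
  then show ?thesis using True by (simp add: absval_def)
next
  case False
  define m where "m = multiplicity p b"
  define n where "n = multiplicity p a"
  have abs: "absval (Fin p) (to_fract a / to_fract b) = 2 powr (- real (degree p) * (real n - real m))"
    using False assms val_fract(1)[OF False assms(2) refl assms(3)] by (simp add: absval_def m_def n_def)
  show ?thesis
  proof (cases "p dvd b")
    case True
    then have "\<not> p dvd a" using assms by (meson coprime_def not_prime_unit)
    then have "n = 0" by (simp add: n_def not_dvd_imp_multiplicity_0)
    then have "absval (Fin p) (to_fract a / to_fract b) = 2 ^ (degree p * m)"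
      unfolding abs by (simp add: powr_realpow[symmetric])
    then show ?thesis by (simp add: m_def)
  next
    case False
    then have m: "m = 0" by (simp add: m_def not_dvd_imp_multiplicity_0)
    then have "absval (Fin p) (to_fract a / to_fract b) \<le> 2 powr 0"
      unfolding abs by (intro powr_mono) auto
    then show ?thesis using m by (simp add: m_def)
  qed
qed

lemma max_one_absval_Infty:
  assumes "coprime a b" "b \<noteq> 0"
  shows "max 1 (absval Infty (to_fract a / to_fract b)) = 2 ^ (degree a - degree b)"
proof (cases "a = 0")
  case True
  then show ?thesis by (simp add: absval_def)
next
  case False
  have abs: "absval Infty (to_fract a / to_fract b) = 2 powr (real (degree a) - real (degree b))"
    using False assms val_fract(2)[OF False assms(2) refl] by (simp add: absval_def)
  show ?thesis
  proof (cases "degree a \<le> degree b")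
    case True
    then have "absval Infty (to_fract a / to_fract b) \<le> 2 powr 0"
      unfolding abs by (intro powr_mono) auto
    then show ?thesis using True by simp
  next
    case False
    then show ?thesis unfolding abs by (simp add: powr_realpow[symmetric] of_nat_diff)
  qed
qed

text \<open>The finite places together contribute \<open>2^(degree b)\<close> through the
  factorisation of \<open>b\<close>. The infinite place contributes
  \<open>2^(degree a - degree b)\<close>, where truncated subtraction takes over the maximum with
  1.\<close>

lemma height_coprime:
  assumes "coprime a b" "b \<noteq> 0"
  shows "height (to_fract a / to_fract b) = 2 ^ max (degree a) (degree b)"
proof -
  let ?y = "to_fract a / to_fract b"
  define S where "S = {p. prime p \<and> p dvd b}"
  have fin: "finite S" unfolding S_def by (rule finite_subset[OF _ finite_divisors[OF assms(2)]]) auto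
  have "height ?y = (\<Prod>w\<in>Fin ` S \<union> {Infty}. max 1 (absval w ?y))"
    unfolding height_def
  proof (rule prod.mono_neutral_left)
    show "{w \<in> places. max 1 (absval w ?y) \<noteq> 1} \<subseteq> Fin ` S \<union> {Infty}"
    proof
      fix w assume w: "w \<in> {w \<in> places. max 1 (absval w ?y) \<noteq> 1}"
      show "w \<in> Fin ` S \<union> {Infty}"
      proof (cases w)
        case (Fin p)
        with w have p: "prime p" and ne: "max 1 (absval (Fin p) ?y) \<noteq> 1" by (auto simp: places_eq)
        have "multiplicity p b \<noteq> 0"
        proof
          assume "multiplicity p b = 0"
          then show False using ne unfolding max_one_absval_Fin[OF assms p] by simp
        qed
        then have "p dvd b" by (rule contrapos_np) (rule not_dvd_imp_multiplicity_0)
        then show ?thesis using p Fin by (simp add: S_def)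
      qed simp
    qed
    show "\<forall>w\<in>Fin ` S \<union> {Infty} - {w \<in> places. max 1 (absval w ?y) \<noteq> 1}. max 1 (absval w ?y) = 1"
      by (auto simp: places_eq S_def)
  qed (use fin in simp)
  also have "\<dots> = (\<Prod>p\<in>S. max 1 (absval (Fin p) ?y)) * max 1 (absval Infty ?y)"
  proof -
    have "(\<Prod>w\<in>Fin ` S \<union> {Infty}. max 1 (absval w ?y)) =
        (\<Prod>w\<in>Fin ` S. max 1 (absval w ?y)) * (\<Prod>w\<in>{Infty}. max 1 (absval w ?y))"
      using fin by (intro prod.union_disjoint) auto
    also have "(\<Prod>w\<in>Fin ` S. max 1 (absval w ?y)) = (\<Prod>p\<in>S. max 1 (absval (Fin p) ?y))"
      by (subst prod.reindex) (auto simp: inj_on_def)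
    finally show ?thesis by simp
  qed
  also have "(\<Prod>p\<in>S. max 1 (absval (Fin p) ?y)) = (\<Prod>p\<in>S. 2 ^ (degree p * multiplicity p b))"
    by (intro prod.cong max_one_absval_Fin[OF assms]) (auto simp: S_def)
  also have "\<dots> = 2 ^ (\<Sum>p\<in>S. degree p * multiplicity p b)" by (simp add: power_sum)
  also have "(\<Sum>p\<in>S. degree p * multiplicity p b) = degree b"
  proof -
    have S: "S = prime_factors b" using assms(2) by (auto simp: S_def prime_factors_dvd)
    have "b = (\<Prod>p\<in>S. p ^ multiplicity p b)"
      unfolding S using prod_prime_factors[OF assms(2)] by simp
    then have "degree b = degree (\<Prod>p\<in>S. p ^ multiplicity p b)" by (rule arg_cong)
    also have "\<dots> = (\<Sum>p\<in>S. degree (p ^ multiplicity p b))"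
      by (rule degree_prod_eq_sum_degree) (auto simp: S_def)
    also have "\<dots> = (\<Sum>p\<in>S. degree p * multiplicity p b)"
      by (intro sum.cong refl) (auto simp: S_def degree_power_eq)
    finally show ?thesis by simp
  qed
  also have "max 1 (absval Infty ?y) = 2 ^ (degree a - degree b)"
    by (rule max_one_absval_Infty[OF assms])
  also have "2 ^ degree b * 2 ^ (degree a - degree b) = (2 :: real) ^ max (degree a) (degree b)"
    by (simp flip: power_add add: max_def)
  finally show ?thesis .
qed

definition height_pairs :: "nat \<Rightarrow> (bit poly \<times> bit poly) set" where
  "height_pairs M = (SIGMA b:{b. b \<noteq> 0 \<and> degree b \<le> M}. {a. degree a \<le> M \<and> to_fract a / to_fract b \<in> normset})"

text \<open>The quantity \<open>R(k)\<close> of the overview.\<close>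

definition weight_sum :: "nat \<Rightarrow> real" where
  "weight_sum k = (\<Sum>b\<in>polys k. (1/2) ^ card (primes_off_t b))"

lemma card_height_pairs: "real (card (height_pairs M)) = 2 ^ M * (\<Sum>k\<le>M. weight_sum k)"
proof -
  have fin: "finite {b :: bit poly. b \<noteq> 0 \<and> degree b \<le> M}"
    by (rule finite_subset[OF _ finite_polys_degree_le[of M]]) auto
  have eq: "{b :: bit poly. b \<noteq> 0 \<and> degree b \<le> M} = (\<Union>k\<le>M. polys k)" by (auto simp: polys_def)
  have "real (card (height_pairs M)) = (\<Sum>b\<in>{b. b \<noteq> 0 \<and> degree b \<le> M}.
      real (card {a. degree a \<le> M \<and> to_fract a / to_fract b \<in> normset}))"
  proof -
    have "card (height_pairs M) = (\<Sum>b\<in>{b. b \<noteq> 0 \<and> degree b \<le> M}.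
      card {a. degree a \<le> M \<and> to_fract a / to_fract b \<in> normset})"
      unfolding height_pairs_def using fin
      by (intro card_SigmaI) (auto intro: finite_subset[OF _ finite_polys_degree_le[of M]])
    then show ?thesis by simp
  qed
  also have "\<dots> = (\<Sum>b\<in>{b. b \<noteq> 0 \<and> degree b \<le> M}. 2 ^ M * (1/2) ^ card (primes_off_t b))"
  proof (rule sum.cong)
    fix b :: "bit poly" assume "b \<in> {b. b \<noteq> 0 \<and> degree b \<le> M}"
    then have "real (card {a. degree a \<le> M \<and> to_fract a / to_fract b \<in> normset} * 2 ^ card (primes_off_t b)) = real (2 ^ M)"
      using card_normset_denominator[of b M] by simp
    then show "real (card {a. degree a \<le> M \<and> to_fract a / to_fract b \<in> normset}) = 2 ^ M * (1/2) ^ card (primes_off_t b)"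
      by (simp add: field_simps power_one_over)
  qed simp
  also have "\<dots> = 2 ^ M * (\<Sum>k\<le>M. weight_sum k)"
    unfolding eq weight_sum_def sum_distrib_left
  proof (rule sum.UNION_disjoint)
    show "\<forall>i\<in>{..M}. finite (polys i)" by simp
  qed (auto simp: polys_def)
  finally show ?thesis .
qed

definition height_set :: "nat \<Rightarrow> K set" where
  "height_set m = {y \<in> normset. height y = 2 ^ m}"

lemma N_eq: "N (2 ^ m) = card (height_set m)"
  unfolding N_def height_set_def conic_has_point_iff by (simp add: conj_commute)

lemma height_set_cases:
  assumes "y \<in> height_set m"
  obtains a b where "y = to_fract a / to_fract b" "b \<noteq> 0" "coprime a b" "max (degree a) (degree b) = m"
proof -
  obtain a b where ab: "y = to_fract a / to_fract b" "b \<noteq> 0" "coprime a b" by (rule K_coprime_cases)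
  have "(2::real) ^ max (degree a) (degree b) = 2 ^ m"
    using height_coprime[OF ab(3,2)] assms ab(1) by (simp add: height_set_def)
  then have "max (degree a) (degree b) = m" by simp
  then show thesis using that ab by blast
qed

text \<open>An element with reduced form \<open>a0/b0\<close> is represented by the pairs \<open>(c b0, c a0)\<close> with \<open>c \<noteq> 0\<close>.\<close>
lemma height_set_fiber:
  assumes y: "y \<in> height_set m" and m: "m \<le> M"
  shows "card {(b, a) \<in> height_pairs M. to_fract a / to_fract b = y} = 2 ^ Suc (M - m) - 1"
proof -
  obtain a0 b0 where ab: "y = to_fract a0 / to_fract b0" "b0 \<noteq> 0" "coprime a0 b0"
    and deg: "max (degree a0) (degree b0) = m" using y by (rule height_set_cases)
  have yS: "y \<in> normset" using y by (simp add: height_set_def)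
  let ?C = "{c :: bit poly. degree c \<le> M - m} - {0}"
  have "{(b, a) \<in> height_pairs M. to_fract a / to_fract b = y} = (\<lambda>c. (c * b0, c * a0)) ` ?C"
  proof (intro equalityI subsetI)
    fix x assume "x \<in> {(b, a) \<in> height_pairs M. to_fract a / to_fract b = y}"
    then obtain a b where x: "x = (b, a)" and b: "b \<noteq> 0" "degree b \<le> M" "degree a \<le> M"
      and eq: "to_fract a / to_fract b = y" by (auto simp: height_pairs_def)
    have eq': "a * b0 = a0 * b" using eq fract_eq_iff_cross[of b b0 a a0] b ab by simp
    then have "b0 dvd a0 * b" by (metis dvd_triv_right)
    then have "b0 dvd b" using ab(3) by (simp add: coprime_commute coprime_dvd_mult_right_iff)
    then obtain c where c: "b = b0 * c" by (auto elim: dvdE)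
    have "a * b0 = (a0 * c) * b0" using eq' c by (simp add: mult_ac)
    then have a: "a = a0 * c" using ab(2) by simp
    have c0: "c \<noteq> 0" using b c by auto
    have "degree c + degree b0 \<le> M" using b c ab(2) c0 by (simp add: degree_mult_eq add.commute)
    moreover have "degree c + degree a0 \<le> M"
    proof (cases "a0 = 0")
      case False
      then show ?thesis using b a c0 by (simp add: degree_mult_eq add.commute)
    qed (use calculation in simp)
    ultimately have "degree c \<le> M - m" using deg m by (auto simp: max_def split: if_splits)
    then have "c \<in> ?C" using c0 by simp
    moreover have "x = (c * b0, c * a0)" using x a c by (simp add: mult.commute)
    ultimately show "x \<in> (\<lambda>c. (c * b0, c * a0)) ` ?C" by (rule rev_image_eqI)
  next
    fix x assume "x \<in> (\<lambda>c. (c * b0, c * a0)) ` ?C"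
    then obtain c where x: "x = (c * b0, c * a0)" and c: "degree c \<le> M - m" "c \<noteq> 0" by auto
    have "degree (c * b0) \<le> M" "degree (c * a0) \<le> M"
      using degree_mult_le[of c b0] degree_mult_le[of c a0] deg m c by auto
    moreover have "to_fract (c * a0) / to_fract (c * b0) = y"
      using fract_eq_iff_cross[of "c * b0" b0 "c * a0" a0] c ab by (simp add: mult_ac)
    ultimately show "x \<in> {(b, a) \<in> height_pairs M. to_fract a / to_fract b = y}"
      using x c ab(2) yS unfolding height_pairs_def by simp
  qed
  moreover have "inj_on (\<lambda>c. (c * b0, c * a0)) ?C" using ab(2) by (auto simp: inj_on_def)
  ultimately have "card {(b, a) \<in> height_pairs M. to_fract a / to_fract b = y} = card ?C"
    by (simp add: card_image)
  also have "\<dots> = 2 ^ Suc (M - m) - 1" by (simp add: card_Diff_subset card_polys_degree_le)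
  finally show ?thesis .
qed

lemma height_pairs_image: "(\<lambda>(b, a). to_fract a / to_fract b) ` height_pairs M = (\<Union>m\<le>M. height_set m)"
proof (intro equalityI subsetI)
  fix y assume "y \<in> (\<lambda>(b, a). to_fract a / to_fract b) ` height_pairs M"
  then obtain a b where y: "y = to_fract a / to_fract b" and b: "b \<noteq> 0" "degree b \<le> M" "degree a \<le> M"
    "y \<in> normset" by (auto simp: height_pairs_def)
  obtain a0 b0 where ab: "y = to_fract a0 / to_fract b0" "b0 \<noteq> 0" "coprime a0 b0" by (rule K_coprime_cases)
  have eq': "a * b0 = a0 * b" using y ab fract_eq_iff_cross[of b b0 a a0] b by simp
  then have "b0 dvd a0 * b" by (metis dvd_triv_right)
  then have "b0 dvd b" using ab(3) by (simp add: coprime_commute coprime_dvd_mult_right_iff)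
  then obtain c where c: "b = b0 * c" by (auto elim: dvdE)
  have "a * b0 = (a0 * c) * b0" using eq' c by (simp add: mult_ac)
  then have a: "a = a0 * c" using ab(2) by simp
  have c0: "c \<noteq> 0" using b c by auto
  have "degree b0 \<le> M" using b c ab(2) c0 by (simp add: degree_mult_eq)
  moreover have "degree a0 \<le> M" using b a c0 by (cases "a0 = 0") (simp_all add: degree_mult_eq)
  ultimately have "max (degree a0) (degree b0) \<le> M" by simp
  moreover have "y \<in> height_set (max (degree a0) (degree b0))"
    using b(4) height_coprime[OF ab(3,2)] ab(1) by (simp add: height_set_def)
  ultimately show "y \<in> (\<Union>m\<le>M. height_set m)" by blast
next
  fix y assume "y \<in> (\<Union>m\<le>M. height_set m)"
  then obtain m where m: "m \<le> M" "y \<in> height_set m" by blast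
  then obtain a b where ab: "y = to_fract a / to_fract b" "b \<noteq> 0" "max (degree a) (degree b) = m"
    by (metis height_set_cases)
  then have "(b, a) \<in> height_pairs M" using m by (auto simp: height_pairs_def height_set_def)
  then show "y \<in> (\<lambda>(b, a). to_fract a / to_fract b) ` height_pairs M"
    by (rule rev_image_eqI) (simp add: ab(1))
qed

lemma finite_height_pairs [simp]: "finite (height_pairs M)"
  unfolding height_pairs_def
  by (intro finite_SigmaI) (auto intro: finite_subset[OF _ finite_polys_degree_le[of M]])

text \<open>Pairs are grouped by the value of the fraction, then by its height; the fibre size
  depends on the height alone.\<close>

lemma card_height_pairs_by_height: "card (height_pairs M) = (\<Sum>m\<le>M. N (2 ^ m) * (2 ^ Suc (M - m) - 1))"
proof -
  let ?f = "\<lambda>(b, a). to_fract a / to_fract b"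
  have fin: "finite (height_set m)" if "m \<le> M" for m
  proof (rule finite_subset)
    show "height_set m \<subseteq> ?f ` height_pairs M" unfolding height_pairs_image using that by blast
  qed simp
  have "card (height_pairs M) = (\<Sum>x\<in>height_pairs M. 1)" by simp
  also have "\<dots> = (\<Sum>y\<in>?f ` height_pairs M. \<Sum>x\<in>{x \<in> height_pairs M. ?f x = y}. 1)"
    by (rule sum.image_gen) simp
  also have "\<dots> = (\<Sum>y\<in>(\<Union>m\<le>M. height_set m). card {(b, a) \<in> height_pairs M. to_fract a / to_fract b = y})"
    unfolding height_pairs_image by (simp add: case_prod_unfold)
  also have "\<dots> = (\<Sum>m\<le>M. \<Sum>y\<in>height_set m. card {(b, a) \<in> height_pairs M. to_fract a / to_fract b = y})"
    using fin by (intro sum.UNION_disjoint) (auto simp: height_set_def)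
  also have "\<dots> = (\<Sum>m\<le>M. \<Sum>y\<in>height_set m. 2 ^ Suc (M - m) - 1)"
    by (intro sum.cong refl height_set_fiber) simp_all
  also have "\<dots> = (\<Sum>m\<le>M. N (2 ^ m) * (2 ^ Suc (M - m) - 1))"
    by (simp add: N_eq)
  finally show ?thesis .
qed

text \<open>Comparing \<open>M\<close> with \<open>M - 1\<close>: the multiplicity \<open>2\<^bsup>M - m + 1\<^esup> - 1\<close> minus twice its predecessor is \<open>1\<close>.\<close>
lemma sum_N: "(\<Sum>m\<le>M. real (N (2 ^ m))) = 2 ^ M * weight_sum M"
proof -
  define g where "g M = (\<Sum>m\<le>M. real (N (2 ^ m)) * (2 ^ Suc (M - m) - 1))" for M
  have g: "g M = 2 ^ M * (\<Sum>k\<le>M. weight_sum k)" for M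
  proof -
    have "real (card (height_pairs M)) = g M"
      unfolding card_height_pairs_by_height g_def by (simp add: of_nat_diff)
    then show ?thesis by (simp add: card_height_pairs)
  qed
  show ?thesis
  proof (cases M)
    case 0
    then show ?thesis using g[of 0] by (simp add: g_def)
  next
    case (Suc n)
    \<comment> \<open>The top index \<open>Suc n\<close> has multiplicity
      \<open>2^1 - 1 = 1\<close>, so its term stands alone.\<close>
    have "g (Suc n) - 2 * g n = (\<Sum>m\<le>n. real (N (2 ^ m)) * (2 ^ Suc (Suc n - m) - 1))
        - (\<Sum>m\<le>n. 2 * (real (N (2 ^ m)) * (2 ^ Suc (n - m) - 1))) + real (N (2 ^ Suc n))"
      unfolding g_def sum_distrib_left by simp
    also have "\<dots> = (\<Sum>m\<le>n. real (N (2 ^ m)) * (2 ^ Suc (Suc n - m) - 1)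
        - 2 * (real (N (2 ^ m)) * (2 ^ Suc (n - m) - 1))) + real (N (2 ^ Suc n))"
      by (simp only: sum_subtractf)
    also have "\<dots> = (\<Sum>m\<le>n. real (N (2 ^ m))) + real (N (2 ^ Suc n))"
      by (intro arg_cong2[of _ _ _ _ "(+)"] sum.cong refl) (simp add: Suc_diff_le algebra_simps)
    finally have "(\<Sum>m\<le>Suc n. real (N (2 ^ m))) = g (Suc n) - 2 * g n" by simp
    also have "\<dots> = 2 ^ Suc n * weight_sum (Suc n)" unfolding g by (simp add: algebra_simps)
    finally show ?thesis using Suc by simp
  qed
qed

lemma N_recursion: "real (N (2 ^ Suc M)) = 2 ^ Suc M * weight_sum (Suc M) - 2 ^ M * weight_sum M"
  using sum_N[of "Suc M"] sum_N[of M] by simp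

section \<open>Euler products as formal power series\<close>

unbundle fps_syntax
unbundle no vec_syntax

definition primes_le :: "nat \<Rightarrow> bit poly set" where
  "primes_le n = {p. prime p \<and> degree p \<le> n}"

lemma finite_primes_le [simp]: "finite (primes_le n)"
  by (rule finite_subset[OF _ finite_polys_degree_le[of n]]) (auto simp: primes_le_def)

text \<open>The series \<open>1/(1 - 2v)\<close>; by \<open>card_polys\<close> it counts nonzero
  polynomials by degree.\<close>

definition geom2 :: "real fps" where "geom2 = Abs_fps (\<lambda>k. 2 ^ k)"

lemma subset_power_sum:
  fixes l :: "'a :: comm_semiring_1"
  assumes "finite A"
  shows "(\<Sum>I\<in>Pow A. l ^ card I) = (1 + l) ^ card A"
  using prod_add[OF assms, of "\<lambda>_. l" "\<lambda>_. 1"] by (simp add: add.commute)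

lemma degree_prod_primes:
  assumes "finite I" "\<And>p. p \<in> I \<Longrightarrow> prime (p :: bit poly)"
  shows "degree (\<Prod>I) = (\<Sum>p\<in>I. degree p)"
proof (rule degree_prod_eq_sum_degree)
  show "\<forall>p\<in>I. p \<noteq> 0" using assms(2) not_prime_0 by blast
qed

text \<open>Expanding the product over subsets of \<open>Q\<close>, the term of \<open>I\<close>
  counts the multiples of \<open>\<Prod>I\<close> with weight \<open>l ^ card I\<close>. After
  exchanging sums, each \<open>b\<close> collects \<open>l ^ card I\<close> over all sets
  \<open>I\<close> of its prime divisors in \<open>Q\<close>.\<close>

lemma prod_primes_mult_geom2:
  fixes l :: real
  assumes fin: "finite Q" and pr: "\<And>p. p \<in> Q \<Longrightarrow> prime (p :: bit poly)"
  shows "((\<Prod>p\<in>Q. 1 + fps_const l * fps_X ^ degree p) * geom2) $ k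
           = (\<Sum>b\<in>polys k. (1 + l) ^ card {p \<in> Q. p dvd b})"
proof -
  have finI: "finite I" if "I \<in> Pow Q" for I using that fin by (auto intro: finite_subset)
  have prI: "prime p" if "I \<in> Pow Q" "p \<in> I" for I p using that pr by auto
  have "(\<Prod>p\<in>Q. 1 + fps_const l * fps_X ^ degree p) = (\<Prod>p\<in>Q. fps_const l * fps_X ^ degree p + 1)"
    by (simp add: add.commute)
  also have "\<dots> = (\<Sum>I\<in>Pow Q. \<Prod>p\<in>I. fps_const l * fps_X ^ degree p)"
    by (subst prod_add[OF fin]) simp
  also have "\<dots> = (\<Sum>I\<in>Pow Q. fps_const (l ^ card I) * fps_X ^ degree (\<Prod>I))"
  proof (rule sum.cong)
    fix I assume I: "I \<in> Pow Q"
    have "degree (\<Prod>I) = (\<Sum>p\<in>I. degree p)"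
      using finI[OF I] prI[OF I] by (rule degree_prod_primes)
    then show "(\<Prod>p\<in>I. fps_const l * fps_X ^ degree p) = fps_const (l ^ card I) * fps_X ^ degree (\<Prod>I)"
      by (simp add: prod.distrib power_sum flip: fps_const_power)
  qed simp
  finally have "((\<Prod>p\<in>Q. 1 + fps_const l * fps_X ^ degree p) * geom2) $ k
      = (\<Sum>I\<in>Pow Q. (fps_const (l ^ card I) * (fps_X ^ degree (\<Prod>I) * geom2)) $ k)"
    by (simp add: sum_distrib_right fps_sum_nth mult.assoc)
  also have "\<dots> = (\<Sum>I\<in>Pow Q. l ^ card I * real (card {b \<in> polys k. \<Prod>I dvd b}))"
  proof (rule sum.cong)
    fix I assume I: "I \<in> Pow Q"
    have "0 \<notin> I" using prI[OF I] not_prime_0 by blast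
    then have "\<Prod>I \<noteq> 0" using finI[OF I] by simp
    then show "(fps_const (l ^ card I) * (fps_X ^ degree (\<Prod>I) * geom2)) $ k
        = l ^ card I * real (card {b \<in> polys k. \<Prod>I dvd b})"
      by (simp add: card_polys_multiples fps_X_power_mult_nth geom2_def)
  qed simp
  also have "\<dots> = (\<Sum>I\<in>Pow Q. \<Sum>b\<in>polys k. if \<Prod>I dvd b then l ^ card I else 0)"
    by (intro sum.cong refl) (simp add: sum.If_cases Int_def mult.commute)
  also have "\<dots> = (\<Sum>b\<in>polys k. \<Sum>I\<in>Pow Q. if \<Prod>I dvd b then l ^ card I else 0)"
    by (rule sum.swap)
  also have "\<dots> = (\<Sum>b\<in>polys k. (1 + l) ^ card {p \<in> Q. p dvd b})"
  proof (rule sum.cong)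
    fix b assume "b \<in> polys k"
    have "(\<Sum>I\<in>Pow Q. if \<Prod>I dvd b then l ^ card I else 0) = (\<Sum>I\<in>Pow {p \<in> Q. p dvd b}. l ^ card I)"
    proof (rule sum.mono_neutral_cong_right)
      show "finite (Pow Q)" using fin by simp
      have *: "\<Prod>I dvd b \<longleftrightarrow> (\<forall>p\<in>I. p dvd b)" if "I \<in> Pow Q" for I
        using finI[OF that] prI[OF that] by (rule prod_primes_dvd)
      show "\<forall>I\<in>Pow Q - Pow {p \<in> Q. p dvd b}. (if \<Prod>I dvd b then l ^ card I else 0) = 0"
        using * by auto
      fix I assume "I \<in> Pow {p \<in> Q. p dvd b}"
      then show "(if \<Prod>I dvd b then l ^ card I else 0) = l ^ card I" using *[of I] by auto
    qed auto
    also have "\<dots> = (1 + l) ^ card {p \<in> Q. p dvd b}" by (rule subset_power_sum) (use fin in simp)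
    finally show "(\<Sum>I\<in>Pow Q. if \<Prod>I dvd b then l ^ card I else 0) = (1 + l) ^ card {p \<in> Q. p dvd b}" .
  qed simp
  finally show ?thesis .
qed

text \<open>The case \<open>l = -1\<close>: every nonconstant \<open>b\<close> of degree at most
  \<open>n\<close> has a prime divisor in \<open>primes_le n\<close> and gets weight zero, so only
  \<open>b = 1\<close> remains.\<close>

lemma prod_all_primes_mult_geom2:
  assumes "k \<le> n"
  shows "((\<Prod>p\<in>primes_le n. 1 - fps_X ^ degree p) * geom2) $ k = (if k = 0 then 1 else 0)"
proof -
  have "((\<Prod>p\<in>primes_le n. 1 - fps_X ^ degree p) * geom2) $ k
      = ((\<Prod>p\<in>primes_le n. 1 + fps_const (-1) * fps_X ^ degree p) * geom2) $ k"
    by (simp flip: fps_const_neg)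
  also have "\<dots> = (\<Sum>b\<in>polys k. (1 + (-1)) ^ card {p \<in> primes_le n. p dvd b})"
    by (rule prod_primes_mult_geom2) (auto simp: primes_le_def)
  also have "\<dots> = (if k = 0 then 1 else 0)"
  proof (cases "k = 0")
    case True
    have "polys 0 = {1}" using bit_poly_degree_0 by (auto simp: polys_def)
    moreover have "{p \<in> primes_le n. p dvd 1} = {}" by (auto simp: primes_le_def dest: not_prime_unit)
    then have e: "card {p \<in> primes_le n. p dvd 1} = 0" by (simp only: card.empty)
    ultimately show ?thesis using True by (simp add: e)
  next
    case False
    have "(1 + (-1) :: real) ^ card {p \<in> primes_le n. p dvd b} = 0" if b: "b \<in> polys k" for b
    proof -
      have "b \<noteq> 0" "\<not> is_unit b" using b False by (auto simp: polys_def bit_poly_is_unit_iff)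
      then obtain p where p: "p dvd b" "prime p" using prime_divisor_exists by blast
      then have "degree p \<le> k" using b dvd_imp_degree_le[of p b] by (simp add: polys_def)
      then have "p \<in> {p \<in> primes_le n. p dvd b}" using p assms by (simp add: primes_le_def)
      then have "card {p \<in> primes_le n. p dvd b} \<noteq> 0" by auto
      then show ?thesis by (simp only: add.right_inverse power_0_left if_False)
    qed
    then have "(\<Sum>b\<in>polys k. (1 + (-1) :: real) ^ card {p \<in> primes_le n. p dvd b}) = 0"
      by (intro sum.neutral) blast
    then show ?thesis using False by (simp only: if_False)
  qed
  finally show ?thesis .
qed

text \<open>The case \<open>l = -1/2\<close>; as \<open>k \<le> n\<close>, no prime divisor of
  \<open>b\<close> is missed.\<close>

lemma prod_primes_half_mult_geom2:
  assumes "k \<le> n"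
  shows "((\<Prod>p\<in>primes_le n - {tX}. 1 - fps_const (1/2) * fps_X ^ degree p) * geom2) $ k = weight_sum k"
proof -
  have "((\<Prod>p\<in>primes_le n - {tX}. 1 - fps_const (1/2) * fps_X ^ degree p) * geom2) $ k
      = ((\<Prod>p\<in>primes_le n - {tX}. 1 + fps_const (-(1/2)) * fps_X ^ degree p) * geom2) $ k"
    by (simp only: fps_const_neg[symmetric] minus_mult_left[symmetric] diff_conv_add_uminus)
  also have "\<dots> = (\<Sum>b\<in>polys k. (1 + (-(1/2))) ^ card {p \<in> primes_le n - {tX}. p dvd b})"
    by (rule prod_primes_mult_geom2) (auto simp: primes_le_def)
  also have "\<dots> = weight_sum k"
    unfolding weight_sum_def
  proof (rule sum.cong)
    fix b assume b: "b \<in> polys k"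
    have "degree p \<le> n" if "p dvd b" for p
      using that b assms dvd_imp_degree_le[of p b] by (simp add: polys_def)
    then have "{p \<in> primes_le n - {tX}. p dvd b} = primes_off_t b" by (auto simp: primes_le_def primes_off_t_def)
    then show "(1 + (-(1/2))) ^ card {p \<in> primes_le n - {tX}. p dvd b} = (1/2 :: real) ^ card (primes_off_t b)"
      by simp
  qed simp
  finally show ?thesis .
qed

text \<open>Congruence modulo \<open>X^(n+1)\<close>, which lets finite products stand in for
  infinite Euler products.\<close>

definition fps_agree :: "nat \<Rightarrow> real fps \<Rightarrow> real fps \<Rightarrow> bool" where
  "fps_agree n F G \<longleftrightarrow> (\<forall>k\<le>n. F $ k = G $ k)"

lemma fps_agree_refl [simp]: "fps_agree n F F"
  by (simp add: fps_agree_def)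

lemma fps_agree_sym: "fps_agree n F G \<Longrightarrow> fps_agree n G F"
  by (simp add: fps_agree_def)

lemma fps_agree_trans [trans]: "fps_agree n F G \<Longrightarrow> fps_agree n G H \<Longrightarrow> fps_agree n F H"
  by (simp add: fps_agree_def)

lemma fps_agree_mult:
  assumes "fps_agree n F G" "fps_agree n F' G'"
  shows "fps_agree n (F * F') (G * G')"
  unfolding fps_agree_def
proof (intro allI impI)
  fix k assume "k \<le> n"
  then show "(F * F') $ k = (G * G') $ k"
    unfolding fps_mult_nth using assms by (intro sum.cong refl) (simp add: fps_agree_def)
qed

lemma fps_agree_diff: "fps_agree n F G \<longleftrightarrow> fps_agree n (F - G) 0"
  by (auto simp: fps_agree_def)

text \<open>\<open>F^2 - G^2\<close> factors, and \<open>F + G\<close> is invertible because its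
  constant term is 2.\<close>

lemma fps_agree_square_imp:
  assumes sq: "fps_agree n (F * F) (G * G)" and 0: "F $ 0 = 1" "G $ 0 = 1"
  shows "fps_agree n F G"
proof -
  have nz: "(F + G) $ 0 \<noteq> 0" using 0 by simp
  have "fps_agree n ((F - G) * (F + G)) 0"
    using sq unfolding fps_agree_diff[of n "F * F"] by (simp add: algebra_simps)
  then have "fps_agree n ((F - G) * (F + G) * inverse (F + G)) (0 * inverse (F + G))"
    by (intro fps_agree_mult) simp_all
  moreover have "(F - G) * (F + G) * inverse (F + G) = F - G"
    using inverse_mult_eq_1'[OF nz] by (simp add: mult.assoc)
  ultimately show ?thesis unfolding fps_agree_diff[of n F G] by simp
qed

text \<open>\<open>nbinom k\<close> is the binomial coefficient of \<open>2 k\<close> over \<open>k\<close>, divided by \<open>4\<^sup>k\<close>.\<close>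
primrec nbinom :: "nat \<Rightarrow> real" where
  "nbinom 0 = 1"
| "nbinom (Suc k) = nbinom k * (2 * real k + 1) / (2 * real k + 2)"

definition inv_sqrt :: "real fps" where "inv_sqrt = Abs_fps nbinom"

text \<open>The recurrence for \<open>nbinom\<close> is the differential equation
  \<open>2 (1 - X) F' = F\<close>, which makes the derivative of \<open>F^2 (1 - X)\<close>
  vanish.\<close>

lemma inv_sqrt_square: "inv_sqrt * inv_sqrt * (1 - fps_X) = 1"
proof -
  have d: "fps_const 2 * (fps_deriv inv_sqrt * (1 - fps_X)) = inv_sqrt"
  proof (rule fps_ext)
    fix k
    have "2 * (real k + 1) * nbinom (Suc k) = (2 * real k + 1) * nbinom k" by simp
    then show "(fps_const 2 * (fps_deriv inv_sqrt * (1 - fps_X))) $ k = inv_sqrt $ k"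
      by (cases k) (simp_all add: inv_sqrt_def right_diff_distrib algebra_simps del: nbinom.simps(2))
  qed
  have "fps_deriv (inv_sqrt * inv_sqrt * (1 - fps_X))
      = inv_sqrt * (fps_const 2 * (fps_deriv inv_sqrt * (1 - fps_X))) - inv_sqrt * inv_sqrt"
    by (simp add: algebra_simps numeral_fps_const flip: mult_2)
  also have "\<dots> = 0" unfolding d by simp
  finally have "inv_sqrt * inv_sqrt * (1 - fps_X) = fps_const ((inv_sqrt * inv_sqrt * (1 - fps_X)) $ 0)"
    by (simp only: fps_deriv_eq_0_iff)
  then show ?thesis by (simp add: inv_sqrt_def)
qed

lemma inv_sqrt_compose_square:
  assumes "F $ 0 = 0"
  shows "(inv_sqrt oo F) * (inv_sqrt oo F) * (1 - F) = 1"
proof -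
  have "(inv_sqrt * inv_sqrt * (1 - fps_X)) oo F = 1" unfolding inv_sqrt_square by simp
  then show ?thesis using assms by (simp add: fps_compose_mult_distrib fps_compose_sub_distrib)
qed

definition inv_sqrt2 :: "real fps" where "inv_sqrt2 = inv_sqrt oo (fps_const 2 * fps_X)"

lemma inv_sqrt2_nth: "inv_sqrt2 $ k = 2 ^ k * nbinom k"
  by (simp add: inv_sqrt2_def inv_sqrt_def)

lemma inv_sqrt2_square: "inv_sqrt2 * inv_sqrt2 = geom2"
proof -
  have "geom2 * (1 - fps_const 2 * fps_X) = 1"
  proof (rule fps_ext)
    fix k
    show "(geom2 * (1 - fps_const 2 * fps_X)) $ k = 1 $ k"
      by (cases k) (simp_all add: geom2_def right_diff_distrib mult.left_commute[of _ "fps_const 2"])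
  qed
  moreover have "inv_sqrt2 * inv_sqrt2 * (1 - fps_const 2 * fps_X) = 1"
    unfolding inv_sqrt2_def by (rule inv_sqrt_compose_square) simp
  ultimately have "inv_sqrt2 * inv_sqrt2 * (1 - fps_const 2 * fps_X) = geom2 * (1 - fps_const 2 * fps_X)" by simp
  moreover have "(1 - fps_const 2 * fps_X :: real fps) \<noteq> 0"
  proof
    assume "(1 - fps_const 2 * fps_X :: real fps) = 0"
    then have "(1 - fps_const 2 * fps_X :: real fps) $ 0 = 0" by simp
    then show False by simp
  qed
  ultimately show ?thesis by simp
qed

text \<open>The Euler factor \<open>e\<close> of the overview.\<close>

definition euler_fps :: "real fps" where "euler_fps = inv_sqrt * (1 - fps_const (1/2) * fps_X)"

text \<open>The prime \<open>t\<close> contributes the factor \<open>(1 - v)\<^bsup>-1/2\<^esup>\<close> without the correction \<open>1 - v/2\<close>.\<close>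
definition euler_prod :: "nat \<Rightarrow> real fps" where
  "euler_prod n = inv_sqrt * (\<Prod>p\<in>primes_le n - {tX}. euler_fps oo fps_X ^ degree p)"

text \<open>Its value at 1/4 will account for the factors \<open>1 - 4^(- degree p)\<close> in the
  local constants.\<close>

definition zeta_prod :: "nat \<Rightarrow> real fps" where
  "zeta_prod n = (\<Prod>p\<in>primes_le n. Abs_fps (\<lambda>_. 1) oo fps_X ^ degree p)"

lemma fps_X_power_nth_0: "prime p \<Longrightarrow> (fps_X ^ degree (p :: bit poly) :: real fps) $ 0 = 0"
  using prime_degree_pos[of p] by simp

lemma zeta_prod_agree: "fps_agree n (zeta_prod n) geom2"
proof -
  let ?m = "\<Prod>p\<in>primes_le n. 1 - fps_X ^ degree p :: real fps"
  have one: "Abs_fps (\<lambda>_. 1 :: real) * (1 - fps_X) = 1"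
  proof (rule fps_ext)
    fix k show "(Abs_fps (\<lambda>_. 1 :: real) * (1 - fps_X)) $ k = 1 $ k"
      by (cases k) (simp_all add: right_diff_distrib)
  qed
  have "zeta_prod n * ?m = (\<Prod>p\<in>primes_le n. (Abs_fps (\<lambda>_. 1) oo fps_X ^ degree p) * (1 - fps_X ^ degree p))"
    by (simp add: zeta_prod_def prod.distrib)
  also have "\<dots> = (\<Prod>p\<in>primes_le n. 1)"
  proof (rule prod.cong)
    fix p assume "p \<in> primes_le n"
    then have 0: "(fps_X ^ degree p :: real fps) $ 0 = 0" by (intro fps_X_power_nth_0) (simp add: primes_le_def)
    have "(Abs_fps (\<lambda>_. 1 :: real) * (1 - fps_X)) oo fps_X ^ degree p = 1" unfolding one by simp
    then show "(Abs_fps (\<lambda>_. 1 :: real) oo fps_X ^ degree p) * (1 - fps_X ^ degree p) = 1"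
      using 0 by (simp add: fps_compose_mult_distrib fps_compose_sub_distrib)
  qed simp
  finally have zm: "zeta_prod n * ?m = 1" by simp
  have "fps_agree n (?m * geom2) 1"
    by (simp add: fps_agree_def prod_all_primes_mult_geom2)
  then have "fps_agree n (zeta_prod n * (?m * geom2)) (zeta_prod n * 1)" by (intro fps_agree_mult) simp_all
  then show ?thesis using zm by (simp add: fps_agree_sym flip: mult.assoc)
qed

lemma prod_fps_nth_0: "(\<Prod>p\<in>A. f p :: 'a :: comm_ring_1 fps) $ 0 = (\<Prod>p\<in>A. f p $ 0)"
  by (induction A rule: infinite_finite_induct) simp_all

text \<open>The product \<open>s\<close> of all \<open>(1 - v^(degree p))^(-1/2)\<close> squares to
  \<open>geom2\<close> up to order \<open>n\<close>, so it agrees with \<open>inv_sqrt2\<close>.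
  With \<open>d\<close> the product of the corrections, \<open>s * d * inv_sqrt2\<close> then agrees
  with \<open>d * geom2\<close>, which generates \<open>weight_sum\<close> up to that order.\<close>

lemma euler_prod_agree:
  assumes "n \<ge> 1"
  shows "fps_agree n (euler_prod n * inv_sqrt2) (Abs_fps weight_sum)"
proof -
  let ?m = "\<Prod>p\<in>primes_le n. 1 - fps_X ^ degree p :: real fps"
  let ?d = "\<Prod>p\<in>primes_le n - {tX}. 1 - fps_const (1/2) * fps_X ^ degree p :: real fps"
  let ?s = "\<Prod>p\<in>primes_le n. inv_sqrt oo fps_X ^ degree p"
  have "?s * ?s * ?m = (\<Prod>p\<in>primes_le n. (inv_sqrt oo fps_X ^ degree p) * (inv_sqrt oo fps_X ^ degree p) * (1 - fps_X ^ degree p))"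
    by (simp add: prod.distrib)
  also have "\<dots> = (\<Prod>p\<in>primes_le n. 1)"
    by (intro prod.cong refl inv_sqrt_compose_square fps_X_power_nth_0) (simp add: primes_le_def)
  finally have sm: "?s * ?s * ?m = 1" by simp
  have "fps_agree n (?m * geom2) 1" by (simp add: fps_agree_def prod_all_primes_mult_geom2)
  then have "fps_agree n (?s * ?s * (?m * geom2)) (?s * ?s * 1)" by (intro fps_agree_mult) simp_all
  moreover have "?s * ?s * (?m * geom2) = inv_sqrt2 * inv_sqrt2"
    unfolding inv_sqrt2_square mult.assoc[symmetric] using sm by (simp add: mult.assoc)
  ultimately have sq: "fps_agree n (?s * ?s) (inv_sqrt2 * inv_sqrt2)" by (simp add: fps_agree_sym)
  have s: "fps_agree n ?s inv_sqrt2"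
    using sq by (rule fps_agree_square_imp) (simp_all add: prod_fps_nth_0 inv_sqrt_def inv_sqrt2_nth)
  \<comment> \<open>\<open>n \<ge> 1\<close> puts t among the primes; its factor in
    \<open>?s\<close> receives no correction and becomes the leading
    \<open>inv_sqrt\<close>.\<close>
  have tX: "tX \<in> primes_le n" using assms prime_tX by (simp add: primes_le_def)
  have "?s = (inv_sqrt oo fps_X ^ degree tX) * (\<Prod>p\<in>primes_le n - {tX}. inv_sqrt oo fps_X ^ degree p)"
    by (rule prod.remove[OF _ tX]) simp
  then have "?s * ?d = inv_sqrt * (\<Prod>p\<in>primes_le n - {tX}. (inv_sqrt oo fps_X ^ degree p) * (1 - fps_const (1/2) * fps_X ^ degree p))"
    by (simp add: prod.distrib mult.assoc)
  also have "\<dots> = euler_prod n"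
  proof -
    have "(inv_sqrt oo fps_X ^ degree p) * (1 - fps_const (1/2) * fps_X ^ degree p) = euler_fps oo fps_X ^ degree p"
      if "prime p" for p :: "bit poly"
      using fps_X_power_nth_0[OF that]
      by (simp add: euler_fps_def fps_compose_mult_distrib fps_compose_sub_distrib)
    then show ?thesis unfolding euler_prod_def by (intro arg_cong2[of _ _ _ _ "(*)"] prod.cong refl) (auto simp: primes_le_def)
  qed
  finally have e: "euler_prod n = ?s * ?d" by simp
  have "fps_agree n (euler_prod n * inv_sqrt2) (inv_sqrt2 * ?d * inv_sqrt2)"
    unfolding e by (intro fps_agree_mult s fps_agree_refl)
  also have "inv_sqrt2 * ?d * inv_sqrt2 = ?d * geom2" unfolding inv_sqrt2_square[symmetric] by (simp only: mult_ac)
  also have "fps_agree n (?d * geom2) (Abs_fps weight_sum)"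
    by (simp add: fps_agree_def prod_primes_half_mult_geom2)
  finally show ?thesis .
qed

text \<open>Defined as a quotient so that the factorisation of the generating function is exact;
  \<open>euler_prod_agree_euler_lim\<close> shows it to be the coefficientwise limit of
  \<open>euler_prod\<close>.\<close>

definition euler_lim :: "real fps" where "euler_lim = Abs_fps weight_sum * inverse inv_sqrt2"

lemma weight_sum_eq_euler_lim: "Abs_fps weight_sum = euler_lim * inv_sqrt2"
proof -
  have "inv_sqrt2 $ 0 \<noteq> 0" by (simp add: inv_sqrt2_nth)
  then show ?thesis unfolding euler_lim_def by (simp add: mult.assoc inverse_mult_eq_1)
qed

lemma euler_prod_agree_euler_lim:
  assumes "n \<ge> 1"
  shows "fps_agree n (euler_prod n) euler_lim"
proof -
  have nz: "inv_sqrt2 $ 0 \<noteq> 0" by (simp add: inv_sqrt2_nth)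
  have "fps_agree n (euler_prod n * inv_sqrt2 * inverse inv_sqrt2) euler_lim"
    unfolding euler_lim_def by (intro fps_agree_mult euler_prod_agree assms) simp
  then show ?thesis using inverse_mult_eq_1'[OF nz] by (simp add: mult.assoc)
qed

section \<open>Convergence of the Euler products\<close>

text \<open>Absolute convergence is built in so that products can be evaluated by Cauchy
  multiplication.\<close>

definition fps_evals :: "real fps \<Rightarrow> real \<Rightarrow> real \<Rightarrow> bool" where
  "fps_evals F r v \<longleftrightarrow> summable (\<lambda>k. norm (F $ k * r ^ k)) \<and> (\<lambda>k. F $ k * r ^ k) sums v"

lemma fps_evals_mult:
  assumes "fps_evals F r a" "fps_evals G r b"
  shows "fps_evals (F * G) r (a * b)"
proof -
  let ?f = "\<lambda>k. F $ k * r ^ k" and ?g = "\<lambda>k. G $ k * r ^ k"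
  have f: "summable (\<lambda>k. norm (?f k))" "suminf ?f = a" and g: "summable (\<lambda>k. norm (?g k))" "suminf ?g = b"
    using assms by (auto simp: fps_evals_def sums_iff)
  have eq: "(F * G) $ k * r ^ k = (\<Sum>i\<le>k. ?f i * ?g (k - i))" for k
  proof -
    have "(F * G) $ k * r ^ k = (\<Sum>i\<le>k. F $ i * G $ (k - i) * r ^ k)"
      by (simp add: fps_mult_nth sum_distrib_right atLeast0AtMost)
    also have "\<dots> = (\<Sum>i\<le>k. ?f i * ?g (k - i))"
    proof (rule sum.cong)
      fix i assume "i \<in> {..k}"
      then have "r ^ k = r ^ i * r ^ (k - i)" by (simp flip: power_add)
      then show "F $ i * G $ (k - i) * r ^ k = ?f i * ?g (k - i)" by simp
    qed simp
    finally show ?thesis .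
  qed
  have "(\<lambda>k. (F * G) $ k * r ^ k) sums (a * b)"
    using Cauchy_product_sums[OF f(1) g(1)] unfolding eq f(2) g(2) .
  moreover have "summable (\<lambda>k. norm ((F * G) $ k * r ^ k))"
  proof (rule summable_comparison_test)
    show "summable (\<lambda>k. \<Sum>i\<le>k. norm (?f i) * norm (?g (k - i)))"
      using f(1) g(1) by (intro summable_Cauchy_product) simp_all
    have "norm ((F * G) $ k * r ^ k) \<le> (\<Sum>i\<le>k. norm (?f i) * norm (?g (k - i)))" for k
      unfolding eq by (rule order_trans[OF norm_sum]) (simp only: norm_mult order.refl)
    then have "norm (norm ((F * G) $ k * r ^ k)) \<le> (\<Sum>i\<le>k. norm (?f i) * norm (?g (k - i)))" for k
      by simp
    then show "\<exists>N. \<forall>k\<ge>N. norm (norm ((F * G) $ k * r ^ k)) \<le> (\<Sum>i\<le>k. norm (?f i) * norm (?g (k - i)))"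
      by blast
  qed
  ultimately show ?thesis by (simp add: fps_evals_def)
qed

lemma fps_evals_finite_support:
  assumes "finite A" "\<And>k. k \<notin> A \<Longrightarrow> F $ k = 0"
  shows "fps_evals F r (\<Sum>k\<in>A. F $ k * r ^ k)"
  using assms unfolding fps_evals_def by (auto intro!: summable_finite[of A] sums_finite)

lemma fps_evals_one: "fps_evals 1 r 1"
  using fps_evals_finite_support[of "{0}" 1 r] by simp

lemma fps_evals_prod:
  assumes "finite A" "\<And>p. p \<in> A \<Longrightarrow> fps_evals (f p) r (v p)"
  shows "fps_evals (\<Prod>p\<in>A. f p) r (\<Prod>p\<in>A. v p)"
  using assms by (induction A rule: finite_induct) (auto intro: fps_evals_one fps_evals_mult)

lemma fps_compose_X_power_nth:
  assumes "d > 0"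
  shows "(F oo fps_X ^ d) $ k = (if d dvd k then (F :: 'a :: comm_ring_1 fps) $ (k div d) else 0)"
proof -
  have "(F oo fps_X ^ d) $ k = (\<Sum>i\<in>{0..k}. if d * i = k then F $ i else 0)"
    unfolding fps_compose_nth by (intro sum.cong refl) (simp flip: power_mult)
  also have "\<dots> = (if d dvd k then F $ (k div d) else 0)"
  proof (cases "d dvd k")
    case True
    then have "d * i = k \<longleftrightarrow> i = k div d" for i using assms by auto
    then show ?thesis using True by simp
  next
    case False
    then have "d * i \<noteq> k" for i by auto
    then show ?thesis using False by simp
  qed
  finally show ?thesis .
qed

lemma fps_evals_compose_power:
  assumes "d > 0" "fps_evals F (r ^ d) v"
  shows "fps_evals (F oo fps_X ^ d) r v"
proof -
  have mono: "strict_mono (\<lambda>k. d * k)" using assms(1) by (simp add: strict_mono_def)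
  have zero: "(F oo fps_X ^ d) $ n * r ^ n = 0" if "n \<notin> range (\<lambda>k. d * k)" for n
    using that assms(1) by (auto simp: fps_compose_X_power_nth elim!: dvdE)
  have eq: "(F oo fps_X ^ d) $ (d * k) * r ^ (d * k) = F $ k * (r ^ d) ^ k" for k
    using assms(1) by (simp add: fps_compose_X_power_nth power_mult)
  have "(\<lambda>k. (F oo fps_X ^ d) $ k * r ^ k) sums v"
    using sums_mono_reindex[where g = "\<lambda>k. d * k" and f = "\<lambda>n. (F oo fps_X ^ d) $ n * r ^ n" and c = v, OF mono zero] assms(2) unfolding eq fps_evals_def by simp
  moreover have "summable (\<lambda>k. norm ((F oo fps_X ^ d) $ k * r ^ k))"
  proof -
    have zero': "norm ((F oo fps_X ^ d) $ n * r ^ n) = 0" if "n \<notin> range (\<lambda>k. d * k)" for n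
      using zero[OF that] by simp
    have "summable (\<lambda>k. norm ((F oo fps_X ^ d) $ (d * k) * r ^ (d * k)))"
      using assms(2) unfolding eq fps_evals_def by simp
    then show ?thesis
      using sums_mono_reindex[where g = "\<lambda>k. d * k" and f = "\<lambda>n. norm ((F oo fps_X ^ d) $ n * r ^ n)", OF mono zero']
      unfolding summable_def by blast
  qed
  ultimately show ?thesis by (simp add: fps_evals_def)
qed

lemma fps_evals_geometric:
  assumes "0 \<le> x" "x < 1"
  shows "fps_evals (Abs_fps (\<lambda>_. 1)) x (1 / (1 - x))"
proof -
  have n: "norm x < 1" using assms by simp
  have "norm (x ^ k) = x ^ k" for k using assms by simp
  then show ?thesis using geometric_sums[OF n] summable_geometric[OF n] by (simp add: fps_evals_def)
qed

lemma nbinom_pos: "nbinom k > 0"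
  by (induction k) simp_all

text \<open>Identifies \<open>inv_sqrt\<close> with the binomial series of exponent -1/2, which
  supplies its value.\<close>

lemma nbinom_gbinomial: "nbinom k = (-1) ^ k * ((-1/2) gchoose k)"
proof (induction k)
  case (Suc k)
  have "(-1/2 :: real) * ((-1/2) gchoose k) = real k * ((-1/2) gchoose k) + real (Suc k) * ((-1/2) gchoose (Suc k))"
    by (rule gbinomial_mult_1)
  then have "real (Suc k) * ((-1/2) gchoose (Suc k)) = - (((2 * real k + 1) / 2) * ((-1/2 :: real) gchoose k))"
  proof -
    have "(2 * real k + 1) / 2 * ((-1/2 :: real) gchoose k) = real k * ((-1/2) gchoose k) + ((-1/2) gchoose k) / 2"
      by (simp add: field_simps)
    with \<open>(-1/2 :: real) * ((-1/2) gchoose k) = _\<close> show ?thesis by linarith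
  qed
  then have "((-1/2 :: real) gchoose (Suc k)) = - ((2 * real k + 1) / (2 * real k + 2) * ((-1/2 :: real) gchoose k))"
    by (simp add: field_simps)
  then show ?case using Suc by simp
qed simp

lemma fps_evals_inv_sqrt:
  assumes "0 \<le> x" "x < 1"
  shows "fps_evals inv_sqrt x (1 / sqrt (1 - x))"
proof -
  have "(\<lambda>n. ((-1/2) gchoose n) * (-x) ^ n) sums (1 + (-x)) powr (-1/2)"
    using assms by (intro gen_binomial_real) simp
  moreover have "((-1/2) gchoose n) * (-x) ^ n = inv_sqrt $ n * x ^ n" for n
    unfolding power_minus[of x] by (simp add: inv_sqrt_def nbinom_gbinomial)
  moreover have "(1 + (-x)) powr (-1/2) = 1 / sqrt (1 - x)"
    using assms by (simp add: powr_minus_divide powr_half_sqrt)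
  ultimately have s: "(\<lambda>n. inv_sqrt $ n * x ^ n) sums (1 / sqrt (1 - x))" by simp
  moreover have "norm (inv_sqrt $ n * x ^ n) = inv_sqrt $ n * x ^ n" for n
    using assms nbinom_pos[of n] by (simp add: inv_sqrt_def)
  ultimately show ?thesis by (simp add: fps_evals_def sums_iff)
qed

definition euler_val :: "real \<Rightarrow> real" where "euler_val x = (1 - x / 2) / sqrt (1 - x)"

lemma fps_evals_euler_fps:
  assumes "0 \<le> x" "x < 1"
  shows "fps_evals euler_fps x (euler_val x)"
proof -
  have "fps_evals (1 - fps_const (1/2) * fps_X) x (\<Sum>k\<in>{0,1}. (1 - fps_const (1/2) * fps_X) $ k * x ^ k)"
    by (rule fps_evals_finite_support) (auto simp: fps_X_def)
  then have "fps_evals (1 - fps_const (1/2) * fps_X) x (1 - x / 2)" by simp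
  from fps_evals_mult[OF fps_evals_inv_sqrt[OF assms] this] show ?thesis
    by (simp add: euler_fps_def euler_val_def)
qed

lemma euler_val_nonneg: "0 \<le> x \<Longrightarrow> x < 1 \<Longrightarrow> 0 \<le> euler_val x"
  by (simp add: euler_val_def)

text \<open>The linear terms of numerator and denominator cancel, leaving a quadratic excess. The
  literal factor 1 in the exponent fits the shape of \<open>prod_primes_le_exp\<close>.\<close>

lemma euler_val_le:
  assumes "0 \<le> x" "x \<le> 3/5"
  shows "euler_val x \<le> exp (1 * x\<^sup>2)"
proof -
  have "(1 - x)  * (1 + x\<^sup>2) - (1 - x / 2)\<^sup>2 = x\<^sup>2 * (3/4 - x)"
    by (simp add: power2_eq_square algebra_simps)
  also have "\<dots> \<ge> 0" using assms by simp
  finally have "(1 - x / 2)\<^sup>2 \<le> (1 - x) * (1 + x\<^sup>2)" by simp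
  \<comment> \<open>The additional factor \<open>1 + x^2\<close>, at least 1, prepares for taking
    square roots.\<close>
  also have "\<dots> \<le> (1 - x) * (1 + x\<^sup>2)\<^sup>2"
    using assms by (intro mult_left_mono self_le_power) simp_all
  also have "\<dots> = (sqrt (1 - x) * (1 + x\<^sup>2))\<^sup>2" using assms by (simp add: power_mult_distrib)
  finally have "1 - x / 2 \<le> sqrt (1 - x) * (1 + x\<^sup>2)"
    by (rule power2_le_imp_le) (use assms in simp)
  then have "euler_val x \<le> 1 + x\<^sup>2" using assms by (simp add: euler_val_def field_simps)
  also have "\<dots> \<le> exp (1 * x\<^sup>2)" using exp_ge_add_one_self[of "x\<^sup>2"] by (simp add: add.commute)
  finally show ?thesis .
qed

lemma geometric_factor_le:
  assumes "0 \<le> x" "x \<le> (3/10 :: real)"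
  shows "1 / (1 - x) \<le> exp (2 * x)"
proof -
  have "1 \<le> (1 - x) * (1 + 2 * x)"
    using assms mult_left_mono[of "2 * x" 1 x] by (simp add: algebra_simps)
  then have "1 / (1 - x) \<le> 1 + 2 * x" using assms by (simp add: field_simps)
  also have "\<dots> \<le> exp (2 * x)" by (rule exp_ge_add_one_self)
  finally show ?thesis .
qed

text \<open>There are at most \<open>2^d\<close> primes of degree \<open>d\<close>, so the exponents
  add up to at most \<open>K\<close> times a geometric series of ratio \<open>2 * y\<close>; the
  bound is independent of \<open>n\<close>.\<close>

lemma prod_primes_le_exp:
  fixes f :: "bit poly \<Rightarrow> real"
  assumes A: "A \<subseteq> primes_le n" and y: "0 \<le> y" "y < 1/2" and K: "0 \<le> K"
    and f: "\<And>p. p \<in> A \<Longrightarrow> 0 \<le> f p" "\<And>p. p \<in> A \<Longrightarrow> f p \<le> exp (K * y ^ degree p)"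
  shows "(\<Prod>p\<in>A. f p) \<le> exp (K * (1 / (1 - 2 * y)))"
proof -
  have finA: "finite A" using A finite_primes_le by (rule finite_subset)
  have "(\<Prod>p\<in>A. f p) \<le> (\<Prod>p\<in>A. exp (K * y ^ degree p))"
    using f by (intro prod_mono) auto
  also have "\<dots> = exp (K * (\<Sum>p\<in>A. y ^ degree p))"
    using finA by (simp add: exp_sum sum_distrib_left)
  also have "(\<Sum>p\<in>A. y ^ degree p) \<le> (\<Sum>p\<in>(\<Union>d\<le>n. polys d). y ^ degree p)"
  proof (rule sum_mono2)
    show "A \<subseteq> (\<Union>d\<le>n. polys d)"
    proof
      fix p assume "p \<in> A"
      then have "prime p" "degree p \<le> n" using A by (auto simp: primes_le_def)
      then have "p \<in> polys (degree p)" using not_prime_0 by (auto simp: polys_def)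
      then show "p \<in> (\<Union>d\<le>n. polys d)" using \<open>degree p \<le> n\<close> by blast
    qed
  qed (use y in auto)
  also have "(\<Sum>p\<in>(\<Union>d\<le>n. polys d). y ^ degree p) = (\<Sum>d\<le>n. \<Sum>p\<in>polys d. y ^ degree p)"
  proof (rule sum.UNION_disjoint)
    show "\<forall>i\<in>{..n}. finite (polys i)" by simp
  qed (auto simp: polys_def)
  also have "\<dots> = (\<Sum>d\<le>n. (2 * y) ^ d)"
  proof (rule sum.cong)
    fix d
    have "(\<Sum>p\<in>polys d. y ^ degree p) = (\<Sum>p\<in>polys d. y ^ d)" by (rule sum.cong) (auto simp: polys_def)
    then show "(\<Sum>p\<in>polys d. y ^ degree p) = (2 * y) ^ d" by (simp add: card_polys power_mult_distrib)
  qed simp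
  also have "\<dots> \<le> (\<Sum>d. (2 * y) ^ d)"
    using y by (intro sum_le_suminf summable_geometric) auto
  also have "\<dots> = 1 / (1 - 2 * y)" using y by (intro suminf_geometric) simp
  finally show ?thesis using K by (simp add: mult_left_mono)
qed

text \<open>Nonnegativity bounds each single term at \<open>r\<close> by the whole value there,
  which yields the majorant \<open>C * (x/r)^k\<close> at the smaller point \<open>x\<close>. Each
  coefficient is eventually constant in \<open>n\<close>, so Tannery's theorem gives the
  limit.\<close>

lemma limit_of_agreeing_fps:
  fixes G :: "nat \<Rightarrow> real fps"
  assumes agree: "\<And>n. fps_agree n (G n) F"
    and nonneg: "\<And>n k. 0 \<le> G n $ k"
    and bound: "\<And>n. fps_evals (G n) r (v n)" "\<And>n. v n \<le> C"
    and x: "0 \<le> x" "x < r"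
    and eval: "\<And>n. fps_evals (G n) x (w n)"
  shows "0 \<le> F $ k" "F $ k * r ^ k \<le> C" "summable (\<lambda>k. F $ k * x ^ k)" "w \<longlonglongrightarrow> (\<Sum>k. F $ k * x ^ k)"
proof -
  have r: "r > 0" using x by simp
  have Gb: "G n $ k * r ^ k \<le> C" for n k
  proof -
    have s: "summable (\<lambda>k. G n $ k * r ^ k)" "(\<Sum>k. G n $ k * r ^ k) = v n"
      using bound(1)[of n] by (auto simp: fps_evals_def sums_iff)
    have "(\<Sum>i\<in>{k}. G n $ i * r ^ i) \<le> (\<Sum>k. G n $ k * r ^ k)"
      using s(1) nonneg r by (intro sum_le_suminf) auto
    then show ?thesis using s(2) bound(2)[of n] by simp
  qed
  have eq: "G n $ k = F $ k" if "k \<le> n" for n k using agree[of n] that by (simp add: fps_agree_def)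
  show "0 \<le> F $ k" "F $ k * r ^ k \<le> C" using nonneg[of k k] Gb[of k k] eq[of k k] by simp_all
  have C0: "0 \<le> C" using Gb[of 0 0] nonneg[of 0 0] by simp
  let ?M = "\<lambda>k. C * (x / r) ^ k"
  have lim: "(\<lambda>n. G n $ k * x ^ k) \<longlonglongrightarrow> F $ k * x ^ k" for k
  proof (rule tendsto_eventually)
    show "\<forall>\<^sub>F n in sequentially. G n $ k * x ^ k = F $ k * x ^ k"
      using eventually_ge_at_top[of k] by eventually_elim (simp add: eq)
  qed
  have le: "norm (G n $ k * x ^ k) \<le> ?M k" for n k
  proof -
    have "G n $ k * x ^ k = G n $ k * r ^ k * (x / r) ^ k" using r by (simp add: power_divide)
    also have "\<dots> \<le> C * (x / r) ^ k" using Gb x r by (intro mult_right_mono) auto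
    finally show ?thesis using nonneg[of n k] x by simp
  qed
  have M: "summable ?M" using x r by (intro summable_mult summable_geometric) auto
  note T = tannerys_theorem[where a = "\<lambda>k n. G n $ k * x ^ k" and b = "\<lambda>k. F $ k * x ^ k"
      and F = sequentially and M = ?M]
  have T1: "summable (\<lambda>k. norm (F $ k * x ^ k))" and T2: "(\<lambda>n. \<Sum>k. G n $ k * x ^ k) \<longlonglongrightarrow> (\<Sum>k. F $ k * x ^ k)"
    using T lim le M by (simp_all add: case_prod_unfold)
  show "summable (\<lambda>k. F $ k * x ^ k)" using T1 by (rule summable_norm_cancel)
  have "(\<Sum>k. G n $ k * x ^ k) = w n" for n using eval[of n] by (auto simp: fps_evals_def sums_iff)
  then show "w \<longlonglongrightarrow> (\<Sum>k. F $ k * x ^ k)" using T2 by simp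
qed

definition fps_nonneg :: "real fps \<Rightarrow> bool" where
  "fps_nonneg F \<longleftrightarrow> (\<forall>k. 0 \<le> F $ k)"

lemma fps_nonneg_mult: "fps_nonneg F \<Longrightarrow> fps_nonneg G \<Longrightarrow> fps_nonneg (F * G)"
  by (simp add: fps_nonneg_def fps_mult_nth sum_nonneg)

lemma fps_nonneg_prod:
  assumes "\<And>p. p \<in> A \<Longrightarrow> fps_nonneg (f p)"
  shows "fps_nonneg (\<Prod>p\<in>A. f p)"
  using assms
proof (induction A rule: infinite_finite_induct)
  case (insert p A)
  then show ?case by (simp add: fps_nonneg_mult)
qed (simp_all add: fps_nonneg_def)

lemma fps_nonneg_compose_power: "d > 0 \<Longrightarrow> fps_nonneg F \<Longrightarrow> fps_nonneg (F oo fps_X ^ d)"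
  by (simp add: fps_nonneg_def fps_compose_X_power_nth)

lemma fps_nonneg_inv_sqrt: "fps_nonneg inv_sqrt"
  using nbinom_pos by (simp add: fps_nonneg_def inv_sqrt_def less_imp_le)

lemma euler_fps_nth_Suc: "euler_fps $ Suc k = nbinom (Suc k) - nbinom k / 2"
  by (simp add: euler_fps_def inv_sqrt_def right_diff_distrib mult.left_commute[of _ "fps_const _"] del: nbinom.simps)

text \<open>Successive ratios of \<open>nbinom\<close> are \<open>(2j + 1)/(2j + 2)\<close>, at
  least 1/2, so the correction never outweighs the main term.\<close>

lemma fps_nonneg_euler_fps: "fps_nonneg euler_fps"
  unfolding fps_nonneg_def
proof
  fix k show "0 \<le> euler_fps $ k"
  proof (cases k)
    case 0
    then show ?thesis by (simp add: euler_fps_def inv_sqrt_def)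
  next
    case (Suc j)
    have "nbinom j / 2 \<le> nbinom (Suc j)" using nbinom_pos[of j] by (simp add: field_simps)
    then show ?thesis unfolding Suc euler_fps_nth_Suc by simp
  qed
qed

lemma power_degree_bounds:
  fixes x :: real
  assumes "prime (p :: bit poly)" "0 \<le> x" "x \<le> c" "c < 1"
  shows "degree p > 0" "0 \<le> x ^ degree p" "x ^ degree p \<le> c"
proof -
  show d: "degree p > 0" using assms(1) by (rule prime_degree_pos)
  show "0 \<le> x ^ degree p" using assms by simp
  have "x ^ degree p \<le> x ^ 1" using d assms by (intro power_decreasing) auto
  then show "x ^ degree p \<le> c" using assms by simp
qed

lemma fps_evals_euler_prod:
  assumes "0 \<le> x" "x < 1"
  shows "fps_evals (euler_prod n) x (1 / sqrt (1 - x) * (\<Prod>p\<in>primes_le n - {tX}. euler_val (x ^ degree p)))"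
  unfolding euler_prod_def
proof (intro fps_evals_mult fps_evals_inv_sqrt fps_evals_prod fps_evals_compose_power fps_evals_euler_fps assms)
  fix p assume "p \<in> primes_le n - {tX}"
  then have p: "prime p" by (simp add: primes_le_def)
  show "degree p > 0" "0 \<le> x ^ degree p" "x ^ degree p < 1"
    using power_degree_bounds[OF p assms(1) order_refl assms(2)] assms by auto
qed simp_all

lemma fps_evals_zeta_prod:
  assumes "0 \<le> x" "x < 1"
  shows "fps_evals (zeta_prod n) x (\<Prod>p\<in>primes_le n. 1 / (1 - x ^ degree p))"
  unfolding zeta_prod_def
proof (intro fps_evals_mult fps_evals_prod fps_evals_compose_power fps_evals_geometric assms)
  fix p assume "p \<in> primes_le n"
  then have p: "prime p" by (simp add: primes_le_def)
  show "degree p > 0" "0 \<le> x ^ degree p" "x ^ degree p < 1"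
    using power_degree_bounds[OF p assms(1) order_refl assms(2)] assms by auto
qed simp_all

text \<open>The limit is \<open>1/(1 - 2v)\<close> at \<open>v = 1/4\<close>. The auxiliary radius
  3/10 lies between this point and 1/2, the end of the range of
  \<open>prod_primes_le_exp\<close>.\<close>

lemma prod_zeta_limit: "(\<lambda>n. \<Prod>p\<in>primes_le n. 1 / (1 - (1/4 :: real) ^ degree p)) \<longlonglongrightarrow> 2"
proof -
  have "(\<lambda>n. \<Prod>p\<in>primes_le n. 1 / (1 - (1/4 :: real) ^ degree p)) \<longlonglongrightarrow> (\<Sum>k. geom2 $ k * (1/4) ^ k)"
  proof (rule limit_of_agreeing_fps(4))
    show "fps_agree n (zeta_prod n) geom2" for n by (rule zeta_prod_agree)
    have "fps_nonneg (zeta_prod n)" for n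
      unfolding zeta_prod_def
      by (intro fps_nonneg_prod fps_nonneg_compose_power)
        (auto simp: primes_le_def fps_nonneg_def prime_degree_pos)
    then show "0 \<le> zeta_prod n $ k" for n k by (simp add: fps_nonneg_def)
    show "fps_evals (zeta_prod n) (3/10) (\<Prod>p\<in>primes_le n. 1 / (1 - (3/10) ^ degree p))" for n
      by (rule fps_evals_zeta_prod) simp_all
    show "(\<Prod>p\<in>primes_le n. 1 / (1 - (3/10 :: real) ^ degree p)) \<le> exp (2 * (1 / (1 - 2 * (3/10))))" for n
    proof (rule prod_primes_le_exp)
      show "primes_le n \<subseteq> primes_le n" by blast
      fix p assume "p \<in> primes_le n"
      then have p: "prime p" by (simp add: primes_le_def)
      note b = power_degree_bounds[OF p, of "3/10" "3/10"]
      show "0 \<le> 1 / (1 - (3/10 :: real) ^ degree p)" using b by simp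
      show "1 / (1 - (3/10 :: real) ^ degree p) \<le> exp (2 * (3/10) ^ degree p)"
        using b by (intro geometric_factor_le) auto
    qed simp_all
    show "fps_evals (zeta_prod n) (1/4) (\<Prod>p\<in>primes_le n. 1 / (1 - (1/4) ^ degree p))" for n
      by (rule fps_evals_zeta_prod) simp_all
  qed simp_all
  also have "(\<Sum>k. geom2 $ k * (1/4) ^ k) = (\<Sum>k. (1/2 :: real) ^ k)"
    by (simp add: geom2_def flip: power_mult_distrib)
  also have "\<dots> = 2" using suminf_geometric[of "1/2 :: real"] by simp
  finally show ?thesis .
qed

definition euler_lim_half :: real where "euler_lim_half = (\<Sum>k. euler_lim $ k * (1/2) ^ k)"

text \<open>Any radius strictly between \<open>1/2\<close> and \<open>1 / sqrt 2\<close> would do in place of \<open>3/5\<close>: it must exceed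
  the evaluation point \<open>1/2\<close>, and its square must be below \<open>1/2\<close> since there are up to \<open>2\<^sup>d\<close> primes
  of degree \<open>d\<close>.\<close>
lemma euler_lim_bounds:
  shows euler_lim_nonneg: "0 \<le> euler_lim $ k"
    and euler_lim_le: "\<exists>C. \<forall>k. euler_lim $ k * (3/5) ^ k \<le> C"
    and euler_prod_limit: "(\<lambda>n. sqrt 2 * (\<Prod>p\<in>primes_le n - {tX}. euler_val ((1/2) ^ degree p))) \<longlonglongrightarrow> euler_lim_half"
proof -
  \<comment> \<open>The shift to \<open>Suc n\<close> is made because
    \<open>euler_prod_agree_euler_lim\<close> starts at \<open>n = 1\<close>.\<close>
  define v where "v n = 1 / sqrt (1 - 3/5) * (\<Prod>p\<in>primes_le (Suc n) - {tX}. euler_val ((3/5) ^ degree p))" for n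
  define C where "C = 1 / sqrt (1 - 3/5) * exp (1 * (1 / (1 - 2 * (9/25 :: real))))"
  define w where "w n = 1 / sqrt (1 - 1/2) * (\<Prod>p\<in>primes_le (Suc n) - {tX}. euler_val ((1/2) ^ degree p))" for n
  have 1: "fps_agree n (euler_prod (Suc n)) euler_lim" for n
    using euler_prod_agree_euler_lim[of "Suc n"] by (simp add: fps_agree_def)
  have nn: "fps_nonneg (euler_prod n)" for n
    unfolding euler_prod_def
    by (intro fps_nonneg_mult fps_nonneg_inv_sqrt fps_nonneg_prod fps_nonneg_compose_power fps_nonneg_euler_fps)
      (auto simp: primes_le_def prime_degree_pos)
  have 2: "0 \<le> euler_prod (Suc n) $ k" for n k using nn[of "Suc n"] by (simp add: fps_nonneg_def)
  have 3: "fps_evals (euler_prod (Suc n)) (3/5) (v n)" for n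
    unfolding v_def by (rule fps_evals_euler_prod) simp_all
  have 4: "v n \<le> C" for n
    unfolding v_def C_def
  proof (rule mult_left_mono, rule prod_primes_le_exp)
    show "primes_le (Suc n) - {tX} \<subseteq> primes_le (Suc n)" by blast
    fix p assume "p \<in> primes_le (Suc n) - {tX}"
    then have p: "prime p" by (simp add: primes_le_def)
    note b = power_degree_bounds[OF p, of "3/5" "3/5"]
    show "0 \<le> euler_val ((3/5) ^ degree p)" using b by (intro euler_val_nonneg) auto
    have "euler_val ((3/5) ^ degree p) \<le> exp (1 * ((3/5) ^ degree p)\<^sup>2)" using b by (intro euler_val_le) auto
    also have "((3/5 :: real) ^ degree p)\<^sup>2 = (9/25) ^ degree p"
      by (simp add: power2_eq_square flip: power_mult_distrib)
    finally show "euler_val ((3/5) ^ degree p) \<le> exp (1 * (9/25) ^ degree p)" .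
  qed simp_all
  have 5: "fps_evals (euler_prod (Suc n)) (1/2) (w n)" for n
    unfolding w_def by (rule fps_evals_euler_prod) simp_all
  note L = limit_of_agreeing_fps[OF 1 2 3 4 _ _ 5]
  show "0 \<le> euler_lim $ k" by (rule L(1)) simp_all
  have "euler_lim $ k * (3/5) ^ k \<le> C" for k by (rule L(2)) simp_all
  then show "\<exists>C. \<forall>k. euler_lim $ k * (3/5) ^ k \<le> C" by blast
  have "w \<longlonglongrightarrow> euler_lim_half" unfolding euler_lim_half_def by (rule L(4)) simp_all
  moreover have s2: "1 / sqrt (1 - 1/2) = sqrt 2" by (simp add: real_sqrt_divide)
  ultimately have "(\<lambda>n. sqrt 2 * (\<Prod>p\<in>primes_le (Suc n) - {tX}. euler_val ((1/2) ^ degree p))) \<longlonglongrightarrow> euler_lim_half"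
    unfolding w_def s2 by blast
  then show "(\<lambda>n. sqrt 2 * (\<Prod>p\<in>primes_le n - {tX}. euler_val ((1/2) ^ degree p))) \<longlonglongrightarrow> euler_lim_half"
    by (rule LIMSEQ_imp_Suc)
qed

section \<open>Local factors and the value of the constant\<close>

lemma euler_factor_ramified: "w = Fin tX \<or> w = Infty \<Longrightarrow> euler_factor w = sqrt (1/2) * (3/4)"
proof -
  assume w: "w = Fin tX \<or> w = Infty"
  then have "deg_place w = 1" by auto
  moreover have "c_loc w = 3/4" using w by (auto simp: c_loc_def tX_def powr_minus_divide)
  ultimately show ?thesis by (simp add: euler_factor_def)
qed

text \<open>With \<open>x = 2^(- degree p)\<close> the local constant simplifies to
  \<open>(1 - x/2) (1 + x)\<close>, and
  \<open>sqrt (1 - x) (1 + x) = (1 - x^2) / sqrt (1 - x)\<close>.\<close>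

lemma euler_factor_unramified:
  assumes "prime p" "p \<noteq> tX"
  shows "euler_factor (Fin p) = euler_val ((1/2) ^ degree p) * (1 - (1/4) ^ degree p)"
proof -
  define d where "d = degree p"
  define x :: real where "x = (1/2) ^ d"
  have d: "d > 0" unfolding d_def using assms(1) by (rule prime_degree_pos)
  have "x \<le> (1/2) ^ 1" unfolding x_def using d by (intro power_decreasing) auto
  then have x: "0 < x" "x < 1" by (simp_all add: x_def)
  have p1: "2 powr real d = 1 / x" by (simp add: x_def powr_realpow power_one_over)
  have p2: "2 powr (- real d) = x" by (simp add: x_def powr_minus_divide powr_realpow power_one_over)
  have p3: "2 powr (2 * real d - 1) = 1 / (2 * x\<^sup>2)"
  proof -
    have "2 powr (2 * real d - 1) = (2 powr real d)\<^sup>2 / 2"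
      by (simp add: powr_diff power2_eq_square flip: powr_add)
    then show ?thesis unfolding p1 by (simp add: power_divide)
  qed
  have y: "(1/4 :: real) ^ d = x\<^sup>2" by (simp add: x_def power2_eq_square flip: power_mult_distrib)
  have "c_loc (Fin p) = 1 + 1/2 * (1 / (1/x) * (1 + (1 - x) / (1/x - 1)) - 1 / (1 / (2 * x\<^sup>2)))"
    using assms by (simp add: c_loc_def tX_def Let_def p1 p2 p3 flip: d_def)
  also have "(1 - x) / (1/x - 1) = x" using x by (simp add: field_simps)
  also have "1 + 1/2 * (1 / (1/x) * (1 + x) - 1 / (1 / (2 * x\<^sup>2))) = (1 - x/2) * (1 + x)"
    by (simp add: power2_eq_square field_simps)
  finally have c: "c_loc (Fin p) = (1 - x/2) * (1 + x)" .
  have "euler_factor (Fin p) = sqrt (1 - x) * ((1 - x/2) * (1 + x))"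
    unfolding euler_factor_def c by (simp add: p1 flip: d_def)
  also have "\<dots> = (1 - x/2) * ((sqrt (1 - x) * sqrt (1 - x)) * (1 + x)) / sqrt (1 - x)"
  proof -
    define s where "s = sqrt (1 - x)"
    have "s > 0" using x by (simp add: s_def)
    then show ?thesis unfolding s_def[symmetric] by simp
  qed
  also have "sqrt (1 - x) * sqrt (1 - x) = 1 - x" using x by simp
  also have "(1 - x) * (1 + x) = 1 - x\<^sup>2" by (simp add: power2_eq_square algebra_simps)
  finally show ?thesis unfolding d_def[symmetric] y x_def[symmetric] euler_val_def by simp
qed

text \<open>The places t and infinity give \<open>(3/4)^2 / 2 = 9/32\<close>. Completing the product
  of the \<open>1 - 4^(- degree p)\<close> by the prime t costs a factor 4/3, and
  \<open>9/32 * 4/3 = 3/8\<close>.\<close>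

lemma partial_euler_eq:
  assumes "n \<ge> 1"
  shows "partial_euler n = 3/8 * (\<Prod>p\<in>primes_le n - {tX}. euler_val ((1/2) ^ degree p))
           / (\<Prod>p\<in>primes_le n. 1 / (1 - (1/4) ^ degree p))"
proof -
  let ?Q = "primes_le n - {tX}"
  have tX: "tX \<in> primes_le n" using assms prime_tX by (simp add: primes_le_def)
  have "{w \<in> places. deg_place w \<le> n} = insert Infty (insert (Fin tX) (Fin ` ?Q))"
    using assms prime_tX by (auto simp: places_eq primes_le_def)
  then have "partial_euler n = (\<Prod>w\<in>insert Infty (insert (Fin tX) (Fin ` ?Q)). euler_factor w)"
    unfolding partial_euler_def by simp
  also have "\<dots> = euler_factor Infty * (euler_factor (Fin tX) * (\<Prod>w\<in>Fin ` ?Q. euler_factor w))"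
  proof -
    have 1: "Infty \<notin> insert (Fin tX) (Fin ` ?Q)" and 2: "Fin tX \<notin> Fin ` ?Q" by auto
    show ?thesis by (simp only: prod.insert[OF _ 1] prod.insert[OF _ 2] finite_insert finite_imageI finite_Diff finite_primes_le)
  qed
  also have "(\<Prod>w\<in>Fin ` ?Q. euler_factor w) = (\<Prod>p\<in>?Q. euler_factor (Fin p))"
    by (subst prod.reindex) (auto simp: inj_on_def)
  also have "\<dots> = (\<Prod>p\<in>?Q. euler_val ((1/2) ^ degree p) * (1 - (1/4) ^ degree p))"
    by (rule prod.cong) (auto simp: primes_le_def euler_factor_unramified)
  also have "\<dots> = (\<Prod>p\<in>?Q. euler_val ((1/2) ^ degree p)) * (\<Prod>p\<in>?Q. 1 - (1/4) ^ degree p)"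
    by (rule prod.distrib)
  also have "(\<Prod>p\<in>?Q. 1 - (1/4 :: real) ^ degree p) = (4/3) / (\<Prod>p\<in>primes_le n. 1 / (1 - (1/4) ^ degree p))"
  proof -
    have "(\<Prod>p\<in>primes_le n. 1 / (1 - (1/4 :: real) ^ degree p)) = (4/3) * (\<Prod>p\<in>?Q. 1 / (1 - (1/4) ^ degree p))"
      using prod.remove[OF _ tX, of "\<lambda>p. 1 / (1 - (1/4 :: real) ^ degree p)"] by simp
    then show ?thesis by (simp add: prod_dividef)
  qed
  also have "euler_factor Infty = sqrt (1/2) * (3/4)" by (simp add: euler_factor_ramified)
  also have "euler_factor (Fin tX) = sqrt (1/2) * (3/4)" by (simp add: euler_factor_ramified)
  also have "sqrt (1/2) * (3/4) * (sqrt (1/2) * (3/4) * (P * (4/3 / Z))) = (sqrt (1/2) * sqrt (1/2)) * (3/4) * P / Z" for P Z :: real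
  proof -
    have "s * (3/4) * (s * (3/4) * (P * (4/3 / Z))) = (s * s) * (3/4) * P / Z" for s :: real by simp
    then show ?thesis .
  qed
  also have "sqrt (1/2) * sqrt (1/2) = 1/2" by (simp flip: real_sqrt_mult)
  finally show ?thesis by simp
qed

text \<open>The zeta product tends to 2, and \<open>sqrt 2\<close> is the value at
  \<open>v = 1/2\<close> of the factor \<open>(1 - v)^(-1/2)\<close> included in
  \<open>euler_lim_half\<close>.\<close>

lemma partial_euler_limit: "partial_euler \<longlonglongrightarrow> 3/16 / sqrt 2 * euler_lim_half"
proof -
  let ?e = "\<lambda>n. sqrt 2 * (\<Prod>p\<in>primes_le n - {tX}. euler_val ((1/2) ^ degree p))"
    and ?z = "\<lambda>n. \<Prod>p\<in>primes_le n. 1 / (1 - (1/4 :: real) ^ degree p)"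
  have "(\<lambda>n. 3/8 / sqrt 2 * ?e n / ?z n) \<longlonglongrightarrow> 3/8 / sqrt 2 * euler_lim_half / 2"
    by (intro tendsto_intros euler_prod_limit prod_zeta_limit) simp
  then have "(\<lambda>n. 3/8 / sqrt 2 * ?e n / ?z n) \<longlonglongrightarrow> 3/16 / sqrt 2 * euler_lim_half" by simp
  moreover have "\<forall>\<^sub>F n in sequentially. 3/8 / sqrt 2 * ?e n / ?z n = partial_euler n"
    using eventually_ge_at_top[of 1] by eventually_elim (simp add: partial_euler_eq)
  ultimately show ?thesis by (rule Lim_transform_eventually)
qed

section \<open>Asymptotics\<close>

lemma nbinom_Suc_square: "(2 * real n + 2)\<^sup>2 * (nbinom (Suc n))\<^sup>2 = (2 * real n + 1)\<^sup>2 * (nbinom n)\<^sup>2"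
  by (simp flip: power_mult_distrib add: mult.commute)

text \<open>From \<open>n\<close> to \<open>n + 1\<close> the Wallis product and the other factors
  change by reciprocal ratios. This transfers Wallis' limit to \<open>nbinom\<close>.\<close>

lemma nbinom_wallis:
  "(2 * real n + 1) * (nbinom n)\<^sup>2 * (\<Prod>k=1..n. (4 * real k ^ 2) / (4 * real k ^ 2 - 1)) = 1"
proof (induction n)
  case (Suc n)
  let ?W = "\<Prod>k=1..n. (4 * real k ^ 2) / (4 * real k ^ 2 - 1)"
  have e: "4 * real (Suc n) ^ 2 - 1 = (2 * real n + 1) * (2 * real n + 3)"
    "4 * real (Suc n) ^ 2 = (2 * real n + 2)\<^sup>2" "2 * real (Suc n) + 1 = 2 * real n + 3"
    by (simp_all add: power2_eq_square algebra_simps)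
  have "(2 * real (Suc n) + 1) * (nbinom (Suc n))\<^sup>2 * (?W * ((4 * real (Suc n) ^ 2) / (4 * real (Suc n) ^ 2 - 1)))
      = (2 * real n + 3) * ((2 * real n + 2)\<^sup>2 * (nbinom (Suc n))\<^sup>2) * ?W / ((2 * real n + 1) * (2 * real n + 3))"
    unfolding e(1) unfolding e(2,3) by (simp del: nbinom.simps)
  also have "\<dots> = (2 * real n + 3) * (2 * real n + 1) * ((2 * real n + 1) * (nbinom n)\<^sup>2 * ?W) / ((2 * real n + 1) * (2 * real n + 3))"
    unfolding nbinom_Suc_square by (simp add: power2_eq_square)
  also have "\<dots> = 1" unfolding Suc.IH by (simp add: mult.commute)
  finally have "(2 * real (Suc n) + 1) * (nbinom (Suc n))\<^sup>2 * (?W * ((4 * real (Suc n) ^ 2) / (4 * real (Suc n) ^ 2 - 1))) = 1" .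
  moreover have "(\<Prod>k=1..Suc n. (4 * real k ^ 2) / (4 * real k ^ 2 - 1)) = ((4 * real (Suc n) ^ 2) / (4 * real (Suc n) ^ 2 - 1)) * ?W"
    by (rule prod.nat_ivl_Suc') simp
  ultimately show ?case by (simp only: mult_ac)
qed simp

lemma nbinom_square_limit: "(\<lambda>n. (2 * real n + 1) * (nbinom n)\<^sup>2) \<longlonglongrightarrow> 2 / pi"
proof -
  have "(\<lambda>n. inverse (\<Prod>k=1..n. (4 * real k ^ 2) / (4 * real k ^ 2 - 1))) \<longlonglongrightarrow> inverse (pi / 2)"
    by (intro tendsto_inverse wallis) simp
  moreover have "inverse (\<Prod>k=1..n. (4 * real k ^ 2) / (4 * real k ^ 2 - 1)) = (2 * real n + 1) * (nbinom n)\<^sup>2" for n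
    using nbinom_wallis[of n] by (intro inverse_unique) (simp add: mult.commute)
  ultimately show ?thesis by simp
qed

text \<open>\<open>(2n + 1) nbinom(n)^2\<close> decreases to its limit \<open>2/pi\<close>, since
  \<open>(2n + 1)(2n + 3) \<le> (2n + 2)^2\<close>.\<close>

lemma nbinom_square_ge: "1 / (pi * (real n + 1/2)) \<le> (nbinom n)\<^sup>2"
proof -
  have "decseq (\<lambda>n. (2 * real n + 1) * (nbinom n)\<^sup>2)"
  proof (rule decseq_SucI)
    fix n
    have "(2 * real (Suc n) + 1) * (nbinom (Suc n))\<^sup>2 * (2 * real n + 2)\<^sup>2
        = (2 * real n + 3) * ((2 * real n + 2)\<^sup>2 * (nbinom (Suc n))\<^sup>2)" by (simp del: nbinom.simps)
    also have "\<dots> = ((2 * real n + 3) * (2 * real n + 1)) * ((2 * real n + 1) * (nbinom n)\<^sup>2)"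
      unfolding nbinom_Suc_square by (simp add: power2_eq_square)
    also have "\<dots> \<le> (2 * real n + 2)\<^sup>2 * ((2 * real n + 1) * (nbinom n)\<^sup>2)"
      by (rule mult_right_mono) (simp add: power2_eq_square algebra_simps, simp)
    finally have "(2 * real n + 2)\<^sup>2 * ((2 * real (Suc n) + 1) * (nbinom (Suc n))\<^sup>2)
        \<le> (2 * real n + 2)\<^sup>2 * ((2 * real n + 1) * (nbinom n)\<^sup>2)" by (simp only: mult_ac)
    moreover have "(2 * real n + 2)\<^sup>2 > 0" by simp
    ultimately show "(2 * real (Suc n) + 1) * (nbinom (Suc n))\<^sup>2 \<le> (2 * real n + 1) * (nbinom n)\<^sup>2"
      using mult_le_cancel_left_pos by blast
  qed
  then have "2 / pi \<le> (2 * real n + 1) * (nbinom n)\<^sup>2" using nbinom_square_limit by (rule decseq_ge)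
  then have "(2 / pi) / (2 * real n + 1) \<le> (nbinom n)\<^sup>2" by (subst pos_divide_le_eq) (simp_all add: mult.commute)
  moreover have "(2 / pi) / (2 * real n + 1) = 1 / (pi * (real n + 1/2))" by (simp add: field_simps)
  ultimately show ?thesis by simp
qed

text \<open>\<open>2n nbinom(n)^2\<close> increases to the same limit, since
  \<open>2n (2n + 2) \<le> (2n + 1)^2\<close>.\<close>

lemma nbinom_square_le:
  assumes "n > 0"
  shows "(nbinom n)\<^sup>2 \<le> 1 / (pi * real n)"
proof -
  have "incseq (\<lambda>n. 2 * real n * (nbinom n)\<^sup>2)"
  proof (rule incseq_SucI)
    fix n
    have "2 * real n * (nbinom n)\<^sup>2 * (2 * real n + 2)\<^sup>2 = (2 * real n * (2 * real n + 2)\<^sup>2) * (nbinom n)\<^sup>2" by simp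
    also have "\<dots> \<le> ((2 * real n + 2) * (2 * real n + 1)\<^sup>2) * (nbinom n)\<^sup>2"
      by (intro mult_right_mono) (simp_all add: power2_eq_square algebra_simps)
    also have "\<dots> = 2 * real (Suc n) * ((2 * real n + 2)\<^sup>2 * (nbinom (Suc n))\<^sup>2)"
      unfolding nbinom_Suc_square by simp
    finally have "(2 * real n + 2)\<^sup>2 * (2 * real n * (nbinom n)\<^sup>2) \<le> (2 * real n + 2)\<^sup>2 * (2 * real (Suc n) * (nbinom (Suc n))\<^sup>2)"
      by (simp only: mult_ac)
    moreover have "(2 * real n + 2)\<^sup>2 > 0" by simp
    ultimately show "2 * real n * (nbinom n)\<^sup>2 \<le> 2 * real (Suc n) * (nbinom (Suc n))\<^sup>2"
      using mult_le_cancel_left_pos by blast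
  qed
  moreover have "(\<lambda>n. 2 * real n * (nbinom n)\<^sup>2) \<longlonglongrightarrow> 2 / pi"
  proof -
    have "(\<lambda>n. 2 * (real n / real (Suc (2 * n)))) \<longlonglongrightarrow> 2 * (1/2)"
    proof (rule tendsto_mult_left)
      have "(\<lambda>n. 1 / (2 + inverse (real n))) \<longlonglongrightarrow> 1 / (2 + 0)"
        by (intro tendsto_intros lim_inverse_n) simp
      moreover have "\<forall>\<^sub>F n in sequentially. 1 / (2 + inverse (real n)) = real n / real (Suc (2 * n))"
        using eventually_gt_at_top[of 0] by eventually_elim (simp add: field_simps)
      ultimately show "(\<lambda>n. real n / real (Suc (2 * n))) \<longlonglongrightarrow> 1/2"
        using Lim_transform_eventually by force
    qed
    moreover have "2 * (real n / real (Suc (2 * n))) * ((2 * real n + 1) * (nbinom n)\<^sup>2) = 2 * real n * (nbinom n)\<^sup>2" for n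
    proof -
      have eq: "real (Suc (2 * n)) = 2 * real n + 1" and nz: "2 * real n + 1 \<noteq> 0" by linarith+
      have "2 * (a / d) * (d * c) = 2 * a * c" if "d \<noteq> 0" for a c d :: real using that by simp
      from this[OF nz] show ?thesis unfolding eq .
    qed
    ultimately show ?thesis using tendsto_mult[OF _ nbinom_square_limit] by fastforce
  qed
  ultimately have "2 * real n * (nbinom n)\<^sup>2 \<le> 2 / pi" by (rule incseq_le)
  then show ?thesis using assms by (simp add: field_simps)
qed

definition err_scale :: "nat \<Rightarrow> real" where "err_scale n = 1 / (real n * sqrt (real n))"

text \<open>The leading term of \<open>nbinom n\<close>.\<close>

definition pisqrt :: "nat \<Rightarrow> real" where "pisqrt n = 1 / sqrt (pi * real n)"

lemma pisqrt_pos: "n > 0 \<Longrightarrow> 0 < pisqrt n"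
  by (simp add: pisqrt_def)

lemma pisqrt_square: "n > 0 \<Longrightarrow> (pisqrt n)\<^sup>2 = 1 / (pi * real n)"
  by (simp add: pisqrt_def power_divide)

lemma pisqrt_le: "n > 0 \<Longrightarrow> pisqrt n \<le> 1 / sqrt (real n)"
  unfolding pisqrt_def using pi_ge_two
  by (intro divide_left_mono real_sqrt_le_mono mult_pos_pos) (auto simp: mult_le_cancel_right1)

text \<open>With \<open>p = pisqrt n\<close>,
  \<open>(p - w) p \<le> p^2 - w^2 \<le> p^2/(n + 1)\<close>; dividing by \<open>p\<close> gives the
  order \<open>n^(-3/2)\<close>. Both \<open>nbinom n\<close> and \<open>pisqrt (Suc n)\<close> will
  serve as \<open>w\<close>.\<close>

lemma pisqrt_diff_le:
  assumes n: "n > 0" and w: "0 \<le> w" "w \<le> pisqrt n" and sq: "1 / (pi * (real n + 1)) \<le> w\<^sup>2"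
  shows "\<bar>w - pisqrt n\<bar> \<le> err_scale n"
proof -
  have "(pisqrt n - w) * pisqrt n \<le> (pisqrt n - w) * (pisqrt n + w)"
    using w by (intro mult_left_mono) auto
  also have "\<dots> = (pisqrt n)\<^sup>2 - w\<^sup>2" by (simp add: power2_eq_square algebra_simps)
  also have "\<dots> \<le> (pisqrt n)\<^sup>2 - (pisqrt n)\<^sup>2 * (real n / (real n + 1))"
  proof -
    have "(pisqrt n)\<^sup>2 * (real n / (real n + 1)) = 1 / (pi * (real n + 1))"
      using n by (simp add: pisqrt_square)
    then show ?thesis using sq by simp
  qed
  also have "\<dots> = (pisqrt n)\<^sup>2 * (1 / (real n + 1))" by (simp add: field_simps)
  also have "\<dots> \<le> (pisqrt n)\<^sup>2 * (1 / real n)"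
    using n by (intro mult_left_mono divide_left_mono) auto
  finally have "pisqrt n * (pisqrt n - w) \<le> pisqrt n * (pisqrt n * (1 / real n))"
    by (simp only: power2_eq_square mult_ac)
  then have "pisqrt n - w \<le> pisqrt n * (1 / real n)"
    using pisqrt_pos[OF n] mult_le_cancel_left_pos by blast
  also have "\<dots> \<le> 1 / sqrt (real n) * (1 / real n)"
    using pisqrt_le[OF n] by (intro mult_right_mono) auto
  also have "\<dots> = err_scale n" by (simp add: err_scale_def)
  finally show ?thesis using w by simp
qed

lemma nbinom_le_pisqrt: "n > 0 \<Longrightarrow> nbinom n \<le> pisqrt n"
  by (rule power2_le_imp_le) (simp_all add: pisqrt_square nbinom_square_le less_imp_le[OF pisqrt_pos])

lemma nbinom_asymp:
  assumes "n > 0"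
  shows "\<bar>nbinom n - pisqrt n\<bar> \<le> err_scale n"
proof (rule pisqrt_diff_le[OF assms])
  have "1 / (pi * (real n + 1)) \<le> 1 / (pi * (real n + 1/2))"
    by (intro divide_left_mono mult_left_mono) auto
  then show "1 / (pi * (real n + 1)) \<le> (nbinom n)\<^sup>2" using nbinom_square_ge order_trans by blast
qed (use nbinom_pos less_imp_le nbinom_le_pisqrt assms in auto)

lemma pisqrt_Suc_diff:
  assumes "n > 0"
  shows "\<bar>pisqrt (Suc n) - pisqrt n\<bar> \<le> err_scale n"
proof (rule pisqrt_diff_le[OF assms])
  show "0 \<le> pisqrt (Suc n)" by (simp add: pisqrt_def)
  show "pisqrt (Suc n) \<le> pisqrt n"
    unfolding pisqrt_def using assms by (intro divide_left_mono real_sqrt_le_mono mult_left_mono mult_pos_pos) auto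
  show "1 / (pi * (real n + 1)) \<le> (pisqrt (Suc n))\<^sup>2" by (simp add: pisqrt_square add.commute)
qed

lemma nbinom_Suc_diff: "nbinom n - nbinom (Suc n) = nbinom n / (2 * real n + 2)"
  by (simp add: field_simps)

lemma nbinom_Suc_le: "nbinom (Suc n) \<le> nbinom n"
  using nbinom_Suc_diff[of n] nbinom_pos[of n] by (smt (verit) divide_pos_pos of_nat_0_le_iff)

lemma nbinom_antimono: "m \<le> n \<Longrightarrow> nbinom n \<le> nbinom m"
  by (rule lift_Suc_antimono_le[of nbinom, OF nbinom_Suc_le])

lemma nbinom_le_1: "nbinom n \<le> 1"
  using nbinom_antimono[of 0 n] by simp

lemma err_scale_pos: "n > 0 \<Longrightarrow> 0 < err_scale n"
  by (simp add: err_scale_def)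

lemma err_scale_ge: "n > 0 \<Longrightarrow> 1 / (real n)\<^sup>2 \<le> err_scale n"
proof -
  assume n: "n > 0"
  have "sqrt (real n) \<le> real n" using n by (intro real_le_lsqrt) (auto simp: power2_eq_square)
  then show ?thesis unfolding err_scale_def power2_eq_square
    using n by (intro divide_left_mono mult_left_mono) auto
qed

lemma err_scale_half:
  assumes "n > 0" "n \<le> 2 * i"
  shows "err_scale i \<le> 4 * err_scale n"
proof -
  have i: "i > 0" using assms by simp
  have "sqrt (real n) \<le> sqrt (4 * real i)" using assms by (intro real_sqrt_le_mono) simp
  also have "\<dots> = 2 * sqrt (real i)" by (simp add: real_sqrt_mult)
  finally have "real n * sqrt (real n) \<le> (2 * real i) * (2 * sqrt (real i))"
    using assms by (intro mult_mono) auto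
  then show ?thesis using assms i unfolding err_scale_def by (simp add: field_simps)
qed

text \<open>Telescoping: a single step down from index \<open>i\<close> is at most
  \<open>err_scale i\<close>, and all \<open>i\<close> involved are at least
  \<open>M/2\<close>.\<close>

lemma nbinom_shift_near:
  assumes "M > 0"
  shows "2 * j \<le> M \<Longrightarrow> nbinom (M - j) - nbinom M \<le> real j * (4 * err_scale M)"
proof (induction j)
  case (Suc j)
  define i where "i = M - Suc j"
  have i: "i > 0" "M \<le> 2 * i" "M - j = Suc i" using Suc.prems assms by (auto simp: i_def)
  have "nbinom i - nbinom (Suc i) = nbinom i / (2 * real i + 2)" by (rule nbinom_Suc_diff)
  also have "\<dots> \<le> (1 / sqrt (real i)) / real i"
    using nbinom_le_pisqrt[OF i(1)] pisqrt_le[OF i(1)] i nbinom_pos[of i] by (intro frac_le) auto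
  also have "\<dots> = err_scale i" by (simp add: err_scale_def)
  also have "\<dots> \<le> 4 * err_scale M" using err_scale_half[OF assms i(2)] .
  finally have "nbinom i - nbinom (Suc i) \<le> 4 * err_scale M" .
  moreover have "nbinom (Suc i) - nbinom M \<le> real j * (4 * err_scale M)" using Suc i by simp
  ultimately show ?case by (simp add: i_def algebra_simps)
qed simp

text \<open>Small \<open>j\<close> are covered by \<open>nbinom_shift_near\<close>. If
  \<open>2 * j > M\<close>, the difference is at most 1, and
  \<open>1 \<le> 4 (1 + j)^2 / M^2\<close>. Holding for every \<open>j\<close>, the bound can be
  summed against \<open>euler_coeff\<close>.\<close>

lemma nbinom_shift:
  assumes "M > 0"
  shows "\<bar>(if j \<le> M then nbinom (M - j) else 0) - nbinom M\<bar> \<le> 4 * err_scale M * (1 + real j)\<^sup>2"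
proof (cases "2 * j \<le> M")
  case True
  have "\<bar>nbinom (M - j) - nbinom M\<bar> = nbinom (M - j) - nbinom M" using nbinom_antimono[of "M - j" M] by simp
  also have "\<dots> \<le> real j * (4 * err_scale M)" by (rule nbinom_shift_near[OF assms True])
  also have "\<dots> \<le> (1 + real j)\<^sup>2 * (4 * err_scale M)"
    using err_scale_pos[OF assms] by (intro mult_right_mono) (auto simp: power2_eq_square algebra_simps)
  finally show ?thesis using True by (simp add: mult_ac)
next
  case False
  have "\<bar>(if j \<le> M then nbinom (M - j) else 0) - nbinom M\<bar> \<le> 1"
    using nbinom_le_1[of M] nbinom_le_1[of "M - j"] nbinom_pos[of M] nbinom_pos[of "M - j"] by (auto simp: abs_if)
  also have "1 \<le> 4 * (1 / (real M)\<^sup>2) * (1 + real j)\<^sup>2"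
  proof -
    have "(real M)\<^sup>2 \<le> (2 * (1 + real j))\<^sup>2" using False by (intro power_mono) auto
    also have "(2 * (1 + real j))\<^sup>2 = 4 * (1 + real j)\<^sup>2" by (simp only: power_mult_distrib) simp
    finally have "(real M)\<^sup>2 / (real M)\<^sup>2 \<le> 4 * (1 + real j)\<^sup>2 / (real M)\<^sup>2" by (rule divide_right_mono) simp
    then show ?thesis using assms by simp
  qed
  also have "\<dots> \<le> 4 * err_scale M * (1 + real j)\<^sup>2"
    using err_scale_ge[OF assms] by (intro mult_right_mono mult_left_mono) auto
  finally show ?thesis .
qed

text \<open>Scaling by the singular point \<open>v = 1/2\<close> makes
  \<open>weight_sum M / 2^M\<close> a plain convolution with \<open>nbinom\<close>.\<close>

definition euler_coeff :: "nat \<Rightarrow> real" where "euler_coeff j = euler_lim $ j * (1/2) ^ j"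

lemma euler_coeff_nonneg: "0 \<le> euler_coeff j"
  using euler_lim_nonneg by (simp add: euler_coeff_def)

lemma summable_euler_coeff_square: "summable (\<lambda>j. euler_coeff j * (1 + real j)\<^sup>2)"
proof -
  obtain C where C: "\<And>k. euler_lim $ k * (3/5) ^ k \<le> C" using euler_lim_le by blast
  have "summable (\<lambda>j. (5/6) ^ j * (1 + real j)\<^sup>2)"
  \<comment> \<open>Here 5/6 is \<open>(1/2)/(3/5)\<close>, and 11/12 lies strictly between it and
    1; from index 20 on, \<open>n^2 - 18n - 29\<close> is nonnegative.\<close>
  proof (rule summable_ratio_test[of "11/12" 20])
    fix n :: nat assume n: "20 \<le> n"
    have "n * 20 \<le> n * n" using n by simp
    then have "real n * 20 \<le> real n * real n" by (metis of_nat_le_iff of_nat_mult of_nat_numeral)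
    moreover have "11/12 * (1 + real n)\<^sup>2 - 5/6 * (2 + real n)\<^sup>2 = (real n * real n - 18 * real n - 29) / 12"
      by (simp add: power2_eq_square field_simps)
    moreover have "real n \<ge> 20" using n by simp
    ultimately have "5/6 * (2 + real n)\<^sup>2 \<le> 11/12 * (1 + real n)\<^sup>2"
      by argo
    then have "(5/6) ^ n * (5/6 * (2 + real n)\<^sup>2) \<le> (5/6) ^ n * (11/12 * (1 + real n)\<^sup>2)"
      by (intro mult_left_mono) auto
    then show "norm ((5/6) ^ Suc n * (1 + real (Suc n))\<^sup>2) \<le> 11/12 * norm ((5/6) ^ n * (1 + real n)\<^sup>2)"
      by (simp add: mult_ac)
  qed simp
  then have sm: "summable (\<lambda>j. C * ((5/6) ^ j * (1 + real j)\<^sup>2))" by (rule summable_mult)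
  have le: "euler_coeff j * (1 + real j)\<^sup>2 \<le> C * ((5/6) ^ j * (1 + real j)\<^sup>2)" for j
  proof -
    have "euler_coeff j = euler_lim $ j * (3/5) ^ j * (5/6) ^ j"
      by (simp add: euler_coeff_def flip: power_mult_distrib)
    also have "\<dots> \<le> C * (5/6) ^ j" using C by (intro mult_right_mono) auto
    finally show ?thesis by (simp add: mult_right_mono flip: mult.assoc)
  qed
  show ?thesis
    using sm by (rule summable_comparison_test') (use le euler_coeff_nonneg in auto)
qed

lemma euler_coeff_sums: "euler_coeff sums euler_lim_half"
proof -
  have "summable euler_coeff"
    using summable_euler_coeff_square
  proof (rule summable_comparison_test')
    fix j
    have "euler_coeff j * 1 \<le> euler_coeff j * (1 + real j)\<^sup>2"
      using euler_coeff_nonneg by (intro mult_left_mono) (auto simp: power2_eq_square algebra_simps)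
    then show "norm (euler_coeff j) \<le> euler_coeff j * (1 + real j)\<^sup>2" using euler_coeff_nonneg[of j] by simp
  qed
  moreover have "suminf euler_coeff = euler_lim_half" unfolding euler_lim_half_def euler_coeff_def[abs_def] ..
  ultimately show ?thesis by (simp add: sums_iff)
qed

lemma weight_sum_convolution: "weight_sum M / 2 ^ M = (\<Sum>j\<le>M. euler_coeff j * nbinom (M - j))"
proof -
  have "weight_sum M = (Abs_fps weight_sum) $ M" by simp
  also have "\<dots> = (\<Sum>j\<le>M. euler_lim $ j * (2 ^ (M - j) * nbinom (M - j)))"
    unfolding weight_sum_eq_euler_lim by (simp add: fps_mult_nth inv_sqrt2_nth atLeast0AtMost)
  finally have "weight_sum M / 2 ^ M = (\<Sum>j\<le>M. euler_lim $ j * (2 ^ (M - j) * nbinom (M - j)) / 2 ^ M)"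
    by (simp add: sum_divide_distrib)
  also have "\<dots> = (\<Sum>j\<le>M. euler_coeff j * nbinom (M - j))"
  proof (rule sum.cong)
    fix j assume "j \<in> {..M}"
    then have "(2 :: real) ^ M = 2 ^ j * 2 ^ (M - j)" by (simp flip: power_add)
    then show "euler_lim $ j * (2 ^ (M - j) * nbinom (M - j)) / 2 ^ M = euler_coeff j * nbinom (M - j)"
      by (simp add: euler_coeff_def power_one_over field_simps)
  qed simp
  finally show ?thesis .
qed

text \<open>In the convolution, \<open>nbinom (M - j)\<close> is replaced by \<open>nbinom M\<close>
  at a cost that \<open>nbinom_shift\<close> makes summable. Extension by zero beyond
  \<open>M\<close> turns the finite sum into a series over all \<open>j\<close>.\<close>

lemma weight_sum_asymp: "\<exists>K. \<forall>M>0. \<bar>weight_sum M / 2 ^ M - euler_lim_half * pisqrt M\<bar> \<le> K * err_scale M"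
proof -
  define Y where "Y = (\<Sum>j. euler_coeff j * (1 + real j)\<^sup>2)"
  have "\<bar>weight_sum M / 2 ^ M - euler_lim_half * pisqrt M\<bar> \<le> (4 * Y + \<bar>euler_lim_half\<bar>) * err_scale M" if M: "M > 0" for M
  proof -
    let ?c = "\<lambda>j. if j \<le> M then nbinom (M - j) else 0"
    have "(\<lambda>j. if j \<in> {..M} then euler_coeff j * nbinom (M - j) else 0) sums (\<Sum>j\<in>{..M}. euler_coeff j * nbinom (M - j))"
      by (rule sums_If_finite_set) simp
    then have "(\<lambda>j. euler_coeff j * ?c j) sums (weight_sum M / 2 ^ M)"
      unfolding weight_sum_convolution by (rule back_subst[of "\<lambda>f. f sums _"]) auto
    moreover have "(\<lambda>j. euler_coeff j * nbinom M) sums (euler_lim_half * nbinom M)" using euler_coeff_sums by (rule sums_mult2)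
    ultimately have d: "(\<lambda>j. euler_coeff j * (?c j - nbinom M)) sums (weight_sum M / 2 ^ M - euler_lim_half * nbinom M)"
      unfolding right_diff_distrib by (rule sums_diff)
    have b: "norm (euler_coeff j * (?c j - nbinom M)) \<le> 4 * err_scale M * (euler_coeff j * (1 + real j)\<^sup>2)" for j
    proof -
      have "norm (euler_coeff j * (?c j - nbinom M)) = euler_coeff j * \<bar>?c j - nbinom M\<bar>"
        using euler_coeff_nonneg[of j] by (simp only: real_norm_def abs_mult abs_of_nonneg)
      also have "\<dots> \<le> euler_coeff j * (4 * err_scale M * (1 + real j)\<^sup>2)"
        by (intro mult_left_mono nbinom_shift M euler_coeff_nonneg)
      finally show ?thesis by (simp only: mult_ac)
    qed
    have s: "summable (\<lambda>j. 4 * err_scale M * (euler_coeff j * (1 + real j)\<^sup>2))"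
      by (intro summable_mult summable_euler_coeff_square)
    have "norm (\<Sum>j. euler_coeff j * (?c j - nbinom M)) \<le> (\<Sum>j. 4 * err_scale M * (euler_coeff j * (1 + real j)\<^sup>2))"
      using b s by (rule norm_suminf_le)
    also have "\<dots> = 4 * err_scale M * Y" unfolding Y_def by (rule suminf_mult[OF summable_euler_coeff_square])
    finally have "\<bar>weight_sum M / 2 ^ M - euler_lim_half * nbinom M\<bar> \<le> 4 * err_scale M * Y"
      using d by (simp only: sums_iff real_norm_def)
    moreover have "\<bar>euler_lim_half * nbinom M - euler_lim_half * pisqrt M\<bar> \<le> \<bar>euler_lim_half\<bar> * err_scale M"
      unfolding right_diff_distrib[symmetric] abs_mult by (intro mult_left_mono nbinom_asymp M) simp
    ultimately show ?thesis by (simp add: algebra_simps)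
  qed
  then show ?thesis by blast
qed

text \<open>With \<open>u M\<close> for \<open>weight_sum M / 2^M\<close>, the recursion reads
  \<open>N (2^M) = 4^M (u M - u (M - 1)/4)\<close>, and \<open>1 - 1/4\<close> is the factor
  3/4.\<close>

lemma N_asymp: "\<exists>K. \<forall>M\<ge>2. \<bar>real (N (2 ^ M)) - 3/4 * euler_lim_half * 4 ^ M * pisqrt M\<bar> \<le> K * (4 ^ M * err_scale M)"
proof -
  obtain K where K: "\<And>M. M > 0 \<Longrightarrow> \<bar>weight_sum M / 2 ^ M - euler_lim_half * pisqrt M\<bar> \<le> K * err_scale M"
    using weight_sum_asymp by blast
  \<comment> \<open>The three parts bound \<open>a\<close>, \<open>b/4\<close> and the change of
    \<open>pisqrt\<close> between \<open>M - 1\<close> and \<open>M\<close>; the factors 4 from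
    \<open>err_scale_half\<close> cancel against the quarters.\<close>
  let ?K = "K + \<bar>K\<bar> + \<bar>euler_lim_half\<bar>"
  have "\<bar>real (N (2 ^ M)) - 3/4 * euler_lim_half * 4 ^ M * pisqrt M\<bar> \<le> ?K * (4 ^ M * err_scale M)" if M2: "M \<ge> 2" for M
  proof -
    obtain m where m: "M = Suc m" "m > 0" using M2 by (cases M) auto
    define u where "u = weight_sum M / 2 ^ M"
    define v where "v = weight_sum m / 2 ^ m"
    define a where "a = u - euler_lim_half * pisqrt M"
    define b where "b = v - euler_lim_half * pisqrt m"
    define d where "d = pisqrt M - pisqrt m"
    have h: "err_scale m \<le> 4 * err_scale M" using err_scale_half[of M m] m by simp
    have a: "\<bar>a\<bar> \<le> K * err_scale M" unfolding a_def u_def by (rule K) (simp add: m)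
    have "\<bar>b\<bar> \<le> K * err_scale m" unfolding b_def v_def by (rule K) (simp add: m)
    also have "\<dots> \<le> \<bar>K\<bar> * (4 * err_scale M)" using h err_scale_pos[OF m(2)] by (intro mult_mono) auto
    finally have b: "\<bar>b\<bar> \<le> 4 * (\<bar>K\<bar> * err_scale M)" by simp
    have "\<bar>euler_lim_half * d\<bar> \<le> \<bar>euler_lim_half\<bar> * err_scale m"
      unfolding abs_mult d_def m(1) by (intro mult_left_mono pisqrt_Suc_diff m) simp
    also have "\<dots> \<le> \<bar>euler_lim_half\<bar> * (4 * err_scale M)" using h by (intro mult_left_mono) auto
    finally have d: "\<bar>euler_lim_half * d\<bar> \<le> 4 * (\<bar>euler_lim_half\<bar> * err_scale M)" by simp
    have 4: "(4 :: real) ^ m = 2 ^ m * 2 ^ m" by (simp flip: power_mult_distrib)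
    have "real (N (2 ^ M)) = 4 ^ M * u - 4 ^ M / 4 * v"
      unfolding u_def v_def m(1) N_recursion by (simp add: 4)
    also have "\<dots> = 4 ^ M * (3/4 * euler_lim_half * pisqrt M + (a - b / 4 + euler_lim_half * d / 4))"
      unfolding a_def b_def d_def by (simp add: field_simps)
    finally have "real (N (2 ^ M)) - 3/4 * euler_lim_half * 4 ^ M * pisqrt M = 4 ^ M * (a - b / 4 + euler_lim_half * d / 4)"
      by (simp add: algebra_simps)
    then have "\<bar>real (N (2 ^ M)) - 3/4 * euler_lim_half * 4 ^ M * pisqrt M\<bar> = 4 ^ M * \<bar>a - b / 4 + euler_lim_half * d / 4\<bar>"
      by (simp only: abs_mult) simp
    also have "\<dots> \<le> 4 ^ M * (?K * err_scale M)"
    proof (rule mult_left_mono)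
      have "?K * err_scale M = K * err_scale M + \<bar>K\<bar> * err_scale M + \<bar>euler_lim_half\<bar> * err_scale M" by (simp add: algebra_simps)
      then show "\<bar>a - b / 4 + euler_lim_half * d / 4\<bar> \<le> ?K * err_scale M" using a b d by linarith
    qed simp
    finally show ?thesis by (simp only: mult_ac)
  qed
  then show ?thesis by blast
qed

text \<open>\<open>ln (2^M) = M ln 2\<close>, so the factors \<open>sqrt (ln 2)\<close> cancel, as
  do the factors \<open>sqrt 2\<close>.\<close>

lemma main_term_eq:
  assumes "M > 0"
  shows "4 * sqrt (2 * ln 2 / pi) * (3/16 / sqrt 2 * euler_lim_half) * (2 ^ M)\<^sup>2 / sqrt (ln (2 ^ M))
          = 3/4 * euler_lim_half * 4 ^ M * pisqrt M"
proof -
  have l: "ln (2 :: real) > 0" by simp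
  have e1: "sqrt (2 * ln 2 / pi) = sqrt 2 * sqrt (ln 2) / sqrt pi" by (simp add: real_sqrt_mult real_sqrt_divide)
  have e2: "sqrt (ln (2 ^ M)) = sqrt (real M) * sqrt (ln 2)" by (simp add: ln_realpow real_sqrt_mult)
  have e3: "((2 :: real) ^ M)\<^sup>2 = 4 ^ M" by (simp add: power2_eq_square flip: power_mult_distrib)
  have e4: "pisqrt M = 1 / (sqrt pi * sqrt (real M))" by (simp add: pisqrt_def real_sqrt_mult)
  have "s * l / p * (3/16 / s * x) * q / (m * l) * 4 = 3/4 * x * q * (1 / (p * m))"
    if "s > 0" "l > 0" "p > 0" "m > 0" for s l p m x q :: real
    using that by (simp add: field_simps)
  from this[of "sqrt 2" "sqrt (ln 2)" "sqrt pi" "sqrt (real M)" euler_lim_half "4 ^ M"] show ?thesis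
    unfolding e1 e2 e3 e4 using l assms by (simp add: mult_ac)
qed

text \<open>Since \<open>ln 2 \<le> 1\<close>, passing from \<open>M\<close> to
  \<open>ln (2^M)\<close> in the denominator can only enlarge the error term.\<close>

lemma error_term_ge:
  assumes "M > 0"
  shows "4 ^ M * err_scale M \<le> (2 ^ M)\<^sup>2 / (ln (2 ^ M)) powr (3/2)"
proof -
  have l: "0 < ln (2 :: real)" "ln (2 :: real) \<le> 1" using ln_le_minus_one[of "2 :: real"] by simp_all
  have L: "ln ((2 :: real) ^ M) = real M * ln 2" by (simp add: ln_realpow)
  have pos: "0 < real M * ln 2" using l assms by simp
  have "(real M * ln 2) powr (3/2) = (real M * ln 2) powr (1 + 1/2)" by simp
  also have "\<dots> = (real M * ln 2) * sqrt (real M * ln 2)"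
    using pos by (simp only: powr_add powr_one powr_half_sqrt less_imp_le)
  also have "\<dots> \<le> real M * sqrt (real M)"
  proof -
    have "real M * ln 2 \<le> real M" using l by (simp add: mult_left_le)
    then show ?thesis using pos by (intro mult_mono real_sqrt_le_mono) auto
  qed
  finally have le: "(ln (2 ^ M)) powr (3/2) \<le> real M * sqrt (real M)" unfolding L .
  have gt: "0 < (ln ((2 :: real) ^ M)) powr (3/2)" using pos assms by (simp add: L)
  have "1 / (real M * sqrt (real M)) \<le> 1 / (ln (2 ^ M)) powr (3/2)"
    by (rule frac_le[OF _ _ gt le]) simp_all
  then have "4 ^ M * err_scale M \<le> 4 ^ M * (1 / (ln (2 ^ M)) powr (3/2))"
    unfolding err_scale_def by (intro mult_left_mono) auto
  moreover have "(4 :: real) ^ M = (2 ^ M)\<^sup>2" by (simp add: power2_eq_square flip: power_mult_distrib)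
  ultimately show ?thesis by (simp only: times_divide_eq_right mult_1_right)
qed

theorem theorem1p1:
  shows "\<exists>P. partial_euler \<longlonglongrightarrow> P \<and>
    (let c = 4 * sqrt (2 * ln 2 / pi) * P in
      (\<lambda>M::nat. real (N (2 ^ M)) - c * (2 ^ M)^2 / sqrt (ln (2 ^ M)))
        \<in> O(\<lambda>M::nat. (2 ^ M)^2 / (ln (2 ^ M)) powr (3/2)))"
proof (rule exI[of _ "3/16 / sqrt 2 * euler_lim_half"], unfold Let_def, rule conjI)
  show "partial_euler \<longlonglongrightarrow> 3/16 / sqrt 2 * euler_lim_half" by (rule partial_euler_limit)
  obtain K where K: "\<And>M. M \<ge> 2 \<Longrightarrow>
      \<bar>real (N (2 ^ M)) - 3/4 * euler_lim_half * 4 ^ M * pisqrt M\<bar> \<le> K * (4 ^ M * err_scale M)"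
    using N_asymp by blast
  show "(\<lambda>M::nat. real (N (2 ^ M)) - 4 * sqrt (2 * ln 2 / pi) * (3/16 / sqrt 2 * euler_lim_half) * (2 ^ M)^2 / sqrt (ln (2 ^ M)))
      \<in> O(\<lambda>M::nat. (2 ^ M)^2 / (ln (2 ^ M)) powr (3/2))"
  proof (rule bigoI[of _ "\<bar>K\<bar>"])
    show "\<forall>\<^sub>F M in sequentially.
        norm (real (N (2 ^ M)) - 4 * sqrt (2 * ln 2 / pi) * (3/16 / sqrt 2 * euler_lim_half) * (2 ^ M)^2 / sqrt (ln (2 ^ M)))
        \<le> \<bar>K\<bar> * norm (((2 :: real) ^ M)^2 / (ln (2 ^ M)) powr (3/2))"
      using eventually_ge_at_top[of 2]
    proof eventually_elim
      case (elim M)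
      then have M: "M > 0" by simp
      \<comment> \<open>The sign of \<open>K\<close> is not known, hence the absolute value.\<close>
      have "\<bar>real (N (2 ^ M)) - 3/4 * euler_lim_half * 4 ^ M * pisqrt M\<bar> \<le> \<bar>K\<bar> * (4 ^ M * err_scale M)"
        using K[OF elim] err_scale_pos[OF M] by (smt (verit) mult_right_mono mult_nonneg_nonneg zero_le_power)
      also have "\<dots> \<le> \<bar>K\<bar> * ((2 ^ M)\<^sup>2 / (ln (2 ^ M)) powr (3/2))"
        by (intro mult_left_mono error_term_ge M) simp
      finally show ?case unfolding main_term_eq[OF M] by simp
    qed
  qed
qed

end
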